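(* Let $\Lambda$ be a finite $k$-graph and $(X,\mathcal F,\mu)$ a measure space. For each $1\le i\le k$ suppose $\{\tau_\lambda:D_\lambda\to R_\lambda\}_{\lambda\in\Lambda^{e_i}}$ is a semibranching function system on $(X,\mu)$ with coding map $\tau^{e_i}:X\to X$. For $\eta\in\Lambda$ written as a composition of edges $\eta=\eta_1\cdots\eta_\ell$ define $\tau_\eta=\tau_{\eta_1}\circ\cdots\circ\tau_{\eta_\ell}$, for $v\in\Lambda^0$ let $\tau_v=\mathrm{id}_{D_v}$, and for $m=(m_1,\dots,m_k)\in\mathbb N^k$ let $\tau^m=(\tau^{e_1})^{m_1}\circ\cdots\circ(\tau^{e_k})^{m_k}$. Then the following conditions (i)–(v) hold if and only if the maps $\{\tau_\eta\}_{\eta\in\Lambda}$ together with $\{\tau^m\}_{m\in\mathbb N^k}$ form a $\Lambda$-semibranching function system on $(X,\mu)$: (i) for any edges $\lambda,\nu$ with $s(\lambda)=s(\nu)$ we have $D_\lambda=D_\nu$; writing $D_v$ for this common set when $v=s(\lambda)$, we have $\mu(D_v)>0$ for all $v\in\Lambda^0$; (ii) $\mu(D_v\cap D_w)=0$ for $v\ne w\in\Lambda^0$; (iii) for $i,j\in\{1,\dots,k\}$, if $\lambda\alpha=\nu\beta$ with $\lambda,\beta\in\Lambda^{e_i}$, $\nu,\alpha\in\Lambda^{e_j}$, then $R_\alpha\subseteq D_\lambda$, $R_\beta\subseteq D_\nu$ and $\tau_\lambda\circ\tau_\alpha=\tau_\nu\circ\tau_\beta$; (iv) $\tau^{e_i}\circ\tau^{e_j}=\tau^{e_j}\circ\tau^{e_i}$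 for all $i,j$; (v) $\mu\big(D_v\setminus\bigcup_{g\in v\Lambda^{e_i}}R_g\big)=0$ for all $v\in\Lambda^0$ and $1\le i\le k$.
   Context: $k$-graph: countable small category $\Lambda$ with degree functor $d:\Lambda\to\mathbb N^k$ with unique factorization ($d(\lambda)=m+n\Rightarrow\lambda=\mu\nu$ uniquely, $d(\mu)=m$, $d(\nu)=n$); $\Lambda^n=d^{-1}(n)$, vertices $\Lambda^0$, range/source $r,s$, $v\Lambda^n=\{\lambda\in\Lambda^n:r(\lambda)=v\}$; $e_1,\dots,e_k$ standard basis of $\mathbb N^k$; edges are elements of some $\Lambda^{e_i}$; finite means every $\Lambda^n$ finite. A semibranching function system on $(X,\mu)$ is a finite family of measurable maps $\tau_i:D_i\to X$ on measurable $D_i\subseteq X$, with $R_i=\tau_i(D_i)$, such that $\mu(X\setminus\bigcup_iR_i)=0$, $\mu(R_i\cap R_j)=0$ for $i\neq j$, and the Radon–Nikodym derivative $\Phi_{\tau_i}=d(\mu\circ\tau_i)/d\mu$ exists and is $>0$ $\mu$-a.e. on $D_i$; a measurable $\tau:X\to X$ is a coding map if $\tau\circ\tau_i=\mathrm{id}$ on $D_i$ for all $i$. A $\Lambda$-semibranching function system on $(X,\mu)$ consists of measurable sets $\{D_\lambda\}_{\lambda\in\Lambda}$, prefixing maps $\tau_\lambda:D_\lambda\to X$ and coding maps $\tau^m:X\to X$ ($m\in\mathbb N^k$) such that (a) for each $m$, $\{\tau_\lambda\}_{\lambda\in\Lambda^m}$ is a semibranching function system with coding map $\tau^m$; (b)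 $\tau_v=\mathrm{id}$ and $\mu(D_v)>0$ for $v\in\Lambda^0$; (c) with $R_\lambda=\tau_\lambda(D_\lambda)$, for all $\lambda\in\Lambda$, $\nu\in s(\lambda)\Lambda$ one has $R_\nu\subseteq D_\lambda$ up to a null set and $\tau_\lambda\circ\tau_\nu=\tau_{\lambda\nu}$ a.e.; (d) $\tau^m\circ\tau^n=\tau^{m+n}$ for all $m,n$.
   Formalization: In (i) and (iii) the equalities and inclusions of domains and the equality of composites hold up to null sets (the exact forms can fail for a Λ-semibranching system); D_v is the union of D_λ over edges with s(λ)=v, τ_η uses a fixed edge factorization, and k≥1. *)

theory Defs
  imports "HOL-Analysis.Analysis" "HOL-Library.Function_Algebras"
begin

text \<open>
  A k-graph is represented by its set of morphisms Lam, range and source maps r, s,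
  a (partial) composition cmp (meaningful when s x = r y), and a degree map
  d :: 'a => nat => nat, where an element m of N^k is a function nat => nat vanishing
  outside {0..<k}; the standard basis vector e_i (0 <= i < k) is unit_vec i.
  Objects are identified with identity morphisms, i.e. with the morphisms of degree 0.
\<close>

definition unit_vec :: "nat \<Rightarrow> nat \<Rightarrow> nat" where
  "unit_vec i = (\<lambda>j. if j = i then 1 else 0)"

definition in_Nk :: "nat \<Rightarrow> (nat \<Rightarrow> nat) \<Rightarrow> bool" where
  "in_Nk k m \<longleftrightarrow> (\<forall>i\<ge>k. m i = 0)"

definition kgraph ::
  "nat \<Rightarrow> 'a set \<Rightarrow> ('a \<Rightarrow> 'a) \<Rightarrow> ('a \<Rightarrow> 'a) \<Rightarrow> ('a \<Rightarrow> 'a \<Rightarrow> 'a) \<Rightarrow> ('a \<Rightarrow> nat \<Rightarrow> nat) \<Rightarrow> bool"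
where
  "kgraph k Lam r s cmp d \<longleftrightarrow>
     countable Lam \<and>
     (\<forall>x\<in>Lam. in_Nk k (d x)) \<and>
     (\<forall>x\<in>Lam. r x \<in> Lam \<and> s x \<in> Lam \<and> d (r x) = 0 \<and> d (s x) = 0) \<and>
     (\<forall>v\<in>Lam. d v = 0 \<longrightarrow> r v = v \<and> s v = v) \<and>
     (\<forall>x\<in>Lam. cmp (r x) x = x \<and> cmp x (s x) = x) \<and>
     (\<forall>x\<in>Lam. \<forall>y\<in>Lam. s x = r y \<longrightarrow>
        cmp x y \<in> Lam \<and> r (cmp x y) = r x \<and> s (cmp x y) = s y \<and> d (cmp x y) = d x + d y) \<and>
     (\<forall>x\<in>Lam. \<forall>y\<in>Lam. \<forall>z\<in>Lam. s x = r y \<longrightarrow> s y = r z \<longrightarrow>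
        cmp (cmp x y) z = cmp x (cmp y z)) \<and>
     (\<forall>x\<in>Lam. \<forall>m n. d x = m + n \<longrightarrow>
        (\<exists>!p. fst p \<in> Lam \<and> snd p \<in> Lam \<and> s (fst p) = r (snd p) \<and>
              cmp (fst p) (snd p) = x \<and> d (fst p) = m \<and> d (snd p) = n))"

definition finite_kgraph ::
  "nat \<Rightarrow> 'a set \<Rightarrow> ('a \<Rightarrow> 'a) \<Rightarrow> ('a \<Rightarrow> 'a) \<Rightarrow> ('a \<Rightarrow> 'a \<Rightarrow> 'a) \<Rightarrow> ('a \<Rightarrow> nat \<Rightarrow> nat) \<Rightarrow> bool"
where
  "finite_kgraph k Lam r s cmp d \<longleftrightarrow>
     kgraph k Lam r s cmp d \<and> (\<forall>m. finite {x\<in>Lam. d x = m})"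

definition is_edge :: "nat \<Rightarrow> ('a \<Rightarrow> nat \<Rightarrow> nat) \<Rightarrow> 'a \<Rightarrow> bool" where
  "is_edge k d x \<longleftrightarrow> (\<exists>i<k. d x = unit_vec i)"

text \<open>
  Semibranching function system {tau_i : D_i -> X}_{i in I} on (X, mu) = (space M, emeasure M).
  The Radon-Nikodym derivative of mu o tau_i (the measure A |-> mu(tau_i ` A) on
  measurable A inside D_i) w.r.t. mu exists and is positive a.e. on D_i.
\<close>

definition sbfs :: "'x measure \<Rightarrow> 'i set \<Rightarrow> ('i \<Rightarrow> 'x set) \<Rightarrow> ('i \<Rightarrow> 'x \<Rightarrow> 'x) \<Rightarrow> bool" where
  "sbfs M I D \<tau> \<longleftrightarrow>
     finite I \<and>
     (\<forall>i\<in>I. D i \<in> sets M \<and> \<tau> i \<in> measurable (restrict_space M (D i)) M \<and>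
        (\<exists>\<Phi>\<in>borel_measurable M.
           (\<forall>A\<in>sets M. A \<subseteq> D i \<longrightarrow>
              \<tau> i ` A \<in> sets M \<and> emeasure M (\<tau> i ` A) = (\<integral>\<^sup>+ x\<in>A. \<Phi> x \<partial>M)) \<and>
           (AE x in M. x \<in> D i \<longrightarrow> 0 < \<Phi> x))) \<and>
     emeasure M (space M - (\<Union>i\<in>I. \<tau> i ` D i)) = 0 \<and>
     (\<forall>i\<in>I. \<forall>j\<in>I. i \<noteq> j \<longrightarrow> emeasure M (\<tau> i ` D i \<inter> \<tau> j ` D j) = 0)"

definition coding_map :: "'x measure \<Rightarrow> 'i set \<Rightarrow> ('i \<Rightarrow> 'x set) \<Rightarrow> ('i \<Rightarrow> 'x \<Rightarrow> 'x) \<Rightarrow> ('x \<Rightarrow> 'x) \<Rightarrow> bool" where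
  "coding_map M I D \<tau> c \<longleftrightarrow> c \<in> measurable M M \<and> (\<forall>i\<in>I. \<forall>x\<in>D i. c (\<tau> i x) = x)"

definition lambda_sbfs ::
  "nat \<Rightarrow> 'a set \<Rightarrow> ('a \<Rightarrow> 'a) \<Rightarrow> ('a \<Rightarrow> 'a) \<Rightarrow> ('a \<Rightarrow> 'a \<Rightarrow> 'a) \<Rightarrow> ('a \<Rightarrow> nat \<Rightarrow> nat) \<Rightarrow>
   'x measure \<Rightarrow> ('a \<Rightarrow> 'x set) \<Rightarrow> ('a \<Rightarrow> 'x \<Rightarrow> 'x) \<Rightarrow> ((nat \<Rightarrow> nat) \<Rightarrow> 'x \<Rightarrow> 'x) \<Rightarrow> bool"
where
  "lambda_sbfs k Lam r s cmp d M D \<tau> cod \<longleftrightarrow>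
     \<comment> \<open>(a)\<close>
     (\<forall>m. in_Nk k m \<longrightarrow>
        sbfs M {x\<in>Lam. d x = m} D \<tau> \<and> coding_map M {x\<in>Lam. d x = m} D \<tau> (cod m)) \<and>
     \<comment> \<open>(b)\<close>
     (\<forall>v\<in>Lam. d v = 0 \<longrightarrow> (\<forall>x\<in>D v. \<tau> v x = x) \<and> 0 < emeasure M (D v)) \<and>
     \<comment> \<open>(c)\<close>
     (\<forall>x\<in>Lam. \<forall>y\<in>Lam. r y = s x \<longrightarrow>
        emeasure M (\<tau> y ` D y - D x) = 0 \<and>
        (AE z in M. z \<in> D y \<longrightarrow> \<tau> x (\<tau> y z) = \<tau> (cmp x y) z)) \<and>
     \<comment> \<open>(d)\<close>
     (\<forall>m n. in_Nk k m \<longrightarrow> in_Nk k n \<longrightarrow> (\<forall>z\<in>space M. cod m (cod n z) = cod (m + n) z))"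

fun path_chain :: "('a \<Rightarrow> 'a) \<Rightarrow> ('a \<Rightarrow> 'a) \<Rightarrow> 'a list \<Rightarrow> bool" where
  "path_chain s r [] = True"
| "path_chain s r [x] = True"
| "path_chain s r (x # y # zs) = (s x = r y \<and> path_chain s r (y # zs))"

fun list_comp :: "('a \<Rightarrow> 'a \<Rightarrow> 'a) \<Rightarrow> 'a list \<Rightarrow> 'a" where
  "list_comp cmp [] = undefined"
| "list_comp cmp [x] = x"
| "list_comp cmp (x # y # zs) = cmp x (list_comp cmp (y # zs))"

text \<open>Degrees of the edges of the canonical factorisation of a path of degree m:
  first m_k edges of degree e_k, then m_(k-1) of degree e_(k-1), ..., finally m_1 of degree e_1
  (so that tau^m o tau_eta = id with tau^m = (tau^e1)^m1 o ... o (tau^ek)^mk).\<close>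
definition canon_degs :: "nat \<Rightarrow> (nat \<Rightarrow> nat) \<Rightarrow> (nat \<Rightarrow> nat) list" where
  "canon_degs k m = concat (map (\<lambda>i. replicate (m i) (unit_vec i)) (rev [0..<k]))"

definition canon_path ::
  "nat \<Rightarrow> 'a set \<Rightarrow> ('a \<Rightarrow> 'a) \<Rightarrow> ('a \<Rightarrow> 'a) \<Rightarrow> ('a \<Rightarrow> 'a \<Rightarrow> 'a) \<Rightarrow> ('a \<Rightarrow> nat \<Rightarrow> nat) \<Rightarrow> 'a \<Rightarrow> 'a list"
where
  "canon_path k Lam r s cmp d eta =
     (SOME es. set es \<subseteq> Lam \<and> path_chain s r es \<and> map d es = canon_degs k (d eta) \<and>
               list_comp cmp es = eta)"

fun path_dom :: "('a \<Rightarrow> 'x set) \<Rightarrow> ('a \<Rightarrow> 'x \<Rightarrow> 'x) \<Rightarrow> 'a list \<Rightarrow> 'x set" where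
  "path_dom D \<tau> [] = UNIV"
| "path_dom D \<tau> (e # es) = {x \<in> path_dom D \<tau> es. foldr \<tau> es x \<in> D e}"

text \<open>D_v: the (common) domain of the edges with source v.\<close>
definition vertex_dom ::
  "nat \<Rightarrow> 'a set \<Rightarrow> ('a \<Rightarrow> 'a) \<Rightarrow> ('a \<Rightarrow> nat \<Rightarrow> nat) \<Rightarrow> ('a \<Rightarrow> 'x set) \<Rightarrow> 'a \<Rightarrow> 'x set"
where
  "vertex_dom k Lam s d D v = (\<Union>x\<in>{x\<in>Lam. is_edge k d x \<and> s x = v}. D x)"

definition ext_tau ::
  "nat \<Rightarrow> 'a set \<Rightarrow> ('a \<Rightarrow> 'a) \<Rightarrow> ('a \<Rightarrow> 'a) \<Rightarrow> ('a \<Rightarrow> 'a \<Rightarrow> 'a) \<Rightarrow> ('a \<Rightarrow> nat \<Rightarrow> nat) \<Rightarrow>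
   ('a \<Rightarrow> 'x \<Rightarrow> 'x) \<Rightarrow> 'a \<Rightarrow> 'x \<Rightarrow> 'x"
where
  "ext_tau k Lam r s cmp d \<tau> eta x =
     (if d eta = 0 then x else foldr \<tau> (canon_path k Lam r s cmp d eta) x)"

definition ext_dom ::
  "nat \<Rightarrow> 'a set \<Rightarrow> ('a \<Rightarrow> 'a) \<Rightarrow> ('a \<Rightarrow> 'a) \<Rightarrow> ('a \<Rightarrow> 'a \<Rightarrow> 'a) \<Rightarrow> ('a \<Rightarrow> nat \<Rightarrow> nat) \<Rightarrow>
   ('a \<Rightarrow> 'x set) \<Rightarrow> ('a \<Rightarrow> 'x \<Rightarrow> 'x) \<Rightarrow> 'a \<Rightarrow> 'x set"
where
  "ext_dom k Lam r s cmp d D \<tau> eta =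
     (if d eta = 0 then vertex_dom k Lam s d D eta
      else path_dom D \<tau> (canon_path k Lam r s cmp d eta))"

definition ext_cod :: "nat \<Rightarrow> (nat \<Rightarrow> 'x \<Rightarrow> 'x) \<Rightarrow> (nat \<Rightarrow> nat) \<Rightarrow> 'x \<Rightarrow> 'x" where
  "ext_cod k c m x = foldr (\<lambda>i y. (c i ^^ m i) y) [0..<k] x"

end

theory Submission
  imports Defs
begin

text \<open>
  Compositions of nonsingular maps (those with an a.e. positive Radon--Nikodym derivative) are
  nonsingular, and such maps transport almost-everywhere statements both forwards along images and
  backwards along preimages, so every null-set condition can be handled pointwise almost everywhere.

  From (i)--(v): two edge paths with the same composite induce a.e. equal maps, by induction on the
  length. If the first edges have the same degree they coincide; otherwise both paths are compared
  with paths that start with the two sides of a common commuting square, to which (iii) applies.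
  Iterating (v) along the canonical degree sequence shows that the ranges of each degree cover X,
  and injectivity of the edge maps shows that they are essentially disjoint. Conversely, (i)--(iv)
  are instances of the axioms, and (v) holds because the ranges of degree e_i cover X while
  R_g lies in D_(r g) and the sets D_v are essentially disjoint.
\<close>

section \<open>Nonsingular maps\<close>

text \<open>The condition that \<open>sbfs\<close> places on a single map, split off from covering
  and disjointness so that it can be proved for composites.\<close>

definition rn_map :: "'x measure \<Rightarrow> 'x set \<Rightarrow> ('x \<Rightarrow> 'x) \<Rightarrow> bool" where
  "rn_map M A f \<longleftrightarrow> A \<in> sets M \<and> f \<in> measurable (restrict_space M A) M \<and>
     (\<exists>\<Phi>\<in>borel_measurable M.
        (\<forall>B\<in>sets M. B \<subseteq> A \<longrightarrow> f ` B \<in> sets M \<and> emeasure M (f ` B) = (\<integral>\<^sup>+ x\<in>B. \<Phi> x \<partial>M)) \<and>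
        (AE x in M. x \<in> A \<longrightarrow> 0 < \<Phi> x))"

lemma sbfs_iff_rn_map:
  "sbfs M I D \<tau> \<longleftrightarrow> finite I \<and> (\<forall>i\<in>I. rn_map M (D i) (\<tau> i)) \<and>
     emeasure M (space M - (\<Union>i\<in>I. \<tau> i ` D i)) = 0 \<and>
     (\<forall>i\<in>I. \<forall>j\<in>I. i \<noteq> j \<longrightarrow> emeasure M (\<tau> i ` D i \<inter> \<tau> j ` D j) = 0)"
  unfolding sbfs_def rn_map_def by blast

lemma rn_map_sets: "rn_map M A f \<Longrightarrow> A \<in> sets M"
  by (simp add: rn_map_def)

lemma rn_map_image_sets: "rn_map M A f \<Longrightarrow> f ` A \<in> sets M"
  unfolding rn_map_def by blast

lemma rn_map_id: "A \<in> sets M \<Longrightarrow> rn_map M A (\<lambda>x. x)"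
  unfolding rn_map_def
  by (auto intro!: bexI[of _ "\<lambda>_. 1"] measurable_restrict_space1)

text \<open>Change of variables. Pushing the density \<open>\<Phi>\<close> on \<open>E\<close>
  forward along \<open>f\<close> gives \<open>M\<close> restricted to the image of \<open>E\<close>;
  on a set \<open>X\<close> this is the image formula for the part of \<open>E\<close> that
  \<open>f\<close> sends into \<open>X\<close>. Then \<open>h\<close> is integrated against both
  measures.\<close>

lemma nn_integral_image:
  assumes A: "A \<in> sets M" and f: "f \<in> measurable (restrict_space M A) M"
    and \<Phi>: "\<Phi> \<in> borel_measurable M"
    and im: "\<And>B. B \<in> sets M \<Longrightarrow> B \<subseteq> A \<Longrightarrow> f ` B \<in> sets M \<and> emeasure M (f ` B) = (\<integral>\<^sup>+ x\<in>B. \<Phi> x \<partial>M)"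
    and h: "h \<in> borel_measurable M" and E: "E \<in> sets M" "E \<subseteq> A"
  shows "(\<integral>\<^sup>+ y\<in>f ` E. h y \<partial>M) = (\<integral>\<^sup>+ x\<in>E. (h (f x) * \<Phi> x) \<partial>M)"
proof -
  let ?R = "restrict_space M E"
  have fE: "f \<in> measurable ?R M"
    using measurable_restrict_mono[OF f E(2)] .
  have \<Phi>E: "\<Phi> \<in> borel_measurable ?R"
    using \<Phi> by (rule measurable_restrict_space1)
  have imE: "f ` E \<in> sets M" using im E by blast
  have eq: "distr (density ?R \<Phi>) M f = density M (indicator (f ` E))"
  proof (rule measure_eqI)
    fix X assume "X \<in> sets (distr (density ?R \<Phi>) M f)"
    then have X: "X \<in> sets M" by simp
    have spE: "space ?R = E" using E sets.sets_into_space[OF E(1)] by (auto simp: space_restrict_space)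
    have pre: "f -` X \<inter> E \<in> sets ?R"
      using measurable_sets[OF fE X] spE by simp
    have preM: "f -` X \<inter> E \<in> sets M"
      using pre E by (simp add: sets_restrict_space_iff)
    have "emeasure (distr (density ?R \<Phi>) M f) X = emeasure (density ?R \<Phi>) (f -` X \<inter> E)"
      using fE X spE by (subst emeasure_distr) (auto simp: measurable_def)
    also have "\<dots> = (\<integral>\<^sup>+ x. \<Phi> x * indicator (f -` X \<inter> E) x \<partial>?R)"
      by (rule emeasure_density[OF \<Phi>E pre])
    also have "\<dots> = (\<integral>\<^sup>+ x. \<Phi> x * indicator (f -` X \<inter> E) x * indicator E x \<partial>M)"
      using E by (subst nn_integral_restrict_space) auto
    also have "\<dots> = (\<integral>\<^sup>+ x\<in>f -` X \<inter> E. \<Phi> x \<partial>M)"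
      by (intro nn_integral_cong) (auto simp: indicator_def)
    also have "\<dots> = emeasure M (f ` (f -` X \<inter> E))"
      using im[OF preM] E(2) by (metis le_infI2)
    also have "f ` (f -` X \<inter> E) = f ` E \<inter> X" by auto
    also have "emeasure M (f ` E \<inter> X) = emeasure (density M (indicator (f ` E))) X"
      using X imE by (subst emeasure_density) (auto simp: indicator_inter_arith[symmetric])
    finally show "emeasure (distr (density ?R \<Phi>) M f) X = emeasure (density M (indicator (f ` E))) X" .
  qed simp
  have "(\<integral>\<^sup>+ y\<in>f ` E. h y \<partial>M) = (\<integral>\<^sup>+ y. h y \<partial>density M (indicator (f ` E)))"
    using h imE by (subst nn_integral_density) (auto simp: mult.commute)
  also have "\<dots> = (\<integral>\<^sup>+ x. h (f x) \<partial>density ?R \<Phi>)"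
    unfolding eq[symmetric] using h fE by (subst nn_integral_distr) auto
  also have "\<dots> = (\<integral>\<^sup>+ x. \<Phi> x * h (f x) \<partial>?R)"
    using measurable_compose[OF fE h] by (subst nn_integral_density[OF \<Phi>E]) auto
  also have "\<dots> = (\<integral>\<^sup>+ x\<in>E. (h (f x) * \<Phi> x) \<partial>M)"
    using E by (subst nn_integral_restrict_space) (auto simp: mult.commute)
  finally show ?thesis .
qed

text \<open>If \<open>N\<close> is null, the image of its preimage lies in \<open>N\<close>, so
  \<open>\<Phi>\<close> integrates to zero over the preimage; as \<open>\<Phi>\<close> is positive
  almost everywhere there, the preimage is null.\<close>

lemma rn_map_AE_pullback:
  assumes f: "rn_map M A f" and P: "AE y in M. P y"
  shows "AE x in M. x \<in> A \<longrightarrow> P (f x)"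
proof -
  obtain \<Phi> where \<Phi>: "\<Phi> \<in> borel_measurable M"
    and im: "\<And>B. B \<in> sets M \<Longrightarrow> B \<subseteq> A \<Longrightarrow> f ` B \<in> sets M \<and> emeasure M (f ` B) = (\<integral>\<^sup>+ x\<in>B. \<Phi> x \<partial>M)"
    and pos: "AE x in M. x \<in> A \<longrightarrow> 0 < \<Phi> x"
    using f unfolding rn_map_def by blast
  have A: "A \<in> sets M" and fm: "f \<in> measurable (restrict_space M A) M"
    using f by (auto simp: rn_map_def)
  obtain N where N: "{y\<in>space M. \<not> P y} \<subseteq> N" "N \<in> sets M" "emeasure M N = 0"
    using P by (auto elim!: AE_E)
  have spA: "space (restrict_space M A) = A"
    using sets.sets_into_space[OF A] by (auto simp: space_restrict_space)
  let ?B = "f -` N \<inter> A"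
  have B: "?B \<in> sets M"
    using measurable_sets[OF fm N(2)] A spA by (simp add: sets_restrict_space_iff)
  have "emeasure M (f ` ?B) \<le> emeasure M N"
    using N(2) by (intro emeasure_mono) auto
  then have "(\<integral>\<^sup>+ x\<in>?B. \<Phi> x \<partial>M) = 0"
    using im[OF B] N(3) by auto
  then have "AE x in M. \<Phi> x * indicator ?B x = 0"
    using \<Phi> B by (subst (asm) nn_integral_0_iff_AE) auto
  with pos show ?thesis
  proof eventually_elim
    case (elim x)
    show ?case
    proof
      assume x: "x \<in> A"
      then have "f x \<in> space M"
        using fm spA by (auto simp: measurable_def)
      moreover have "f x \<notin> N"
        using elim x by (auto simp: indicator_def)
      ultimately show "P (f x)" using N(1) by blast
    qed
  qed
qed

text \<open>The measure of the image of a null set is an integral over that null set, hence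
  zero.\<close>

lemma rn_map_AE_image:
  assumes f: "rn_map M A f" and P: "AE x in M. x \<in> A \<longrightarrow> P (f x)"
  shows "AE y in M. y \<in> f ` A \<longrightarrow> P y"
proof -
  obtain \<Phi> where \<Phi>: "\<Phi> \<in> borel_measurable M"
    and im: "\<And>B. B \<in> sets M \<Longrightarrow> B \<subseteq> A \<Longrightarrow> f ` B \<in> sets M \<and> emeasure M (f ` B) = (\<integral>\<^sup>+ x\<in>B. \<Phi> x \<partial>M)"
    using f unfolding rn_map_def by blast
  have A: "A \<in> sets M" using f by (auto simp: rn_map_def)
  obtain N where N: "{x\<in>space M. \<not> (x \<in> A \<longrightarrow> P (f x))} \<subseteq> N" "N \<in> sets M" "emeasure M N = 0"
    using P by (auto elim!: AE_E)
  have NA: "N \<inter> A \<in> sets M" "N \<inter> A \<subseteq> A" using N A by auto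
  have "N \<in> null_sets M" using N by auto
  then have "(\<integral>\<^sup>+ x\<in>N \<inter> A. \<Phi> x \<partial>M) = 0"
    using NA(1) by (intro nn_integral_null_set null_set_Int2) (auto simp: A)
  with im[OF NA] have "f ` (N \<inter> A) \<in> null_sets M" by auto
  moreover have "{y\<in>space M. \<not> (y \<in> f ` A \<longrightarrow> P y)} \<subseteq> f ` (N \<inter> A)"
    using N(1) sets.sets_into_space[OF A] by blast
  ultimately show ?thesis by (rule AE_I')
qed

text \<open>Chain rule: the derivative is \<open>\<Psi> (f x) * \<Phi> x\<close>, by the change of
  variables with \<open>h = \<Psi>\<close>. It is positive because positivity of
  \<open>\<Psi>\<close> pulls back along \<open>f\<close>.\<close>

lemma rn_map_comp:
  assumes f: "rn_map M A f" and g: "rn_map M B g"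
  shows "rn_map M {x\<in>A. f x \<in> B} (\<lambda>x. g (f x))"
proof -
  obtain \<Phi> where \<Phi>: "\<Phi> \<in> borel_measurable M"
    and im: "\<And>B. B \<in> sets M \<Longrightarrow> B \<subseteq> A \<Longrightarrow> f ` B \<in> sets M \<and> emeasure M (f ` B) = (\<integral>\<^sup>+ x\<in>B. \<Phi> x \<partial>M)"
    and pos: "AE x in M. x \<in> A \<longrightarrow> 0 < \<Phi> x"
    using f unfolding rn_map_def by blast
  obtain \<Psi> where \<Psi>: "\<Psi> \<in> borel_measurable M"
    and im': "\<And>C. C \<in> sets M \<Longrightarrow> C \<subseteq> B \<Longrightarrow> g ` C \<in> sets M \<and> emeasure M (g ` C) = (\<integral>\<^sup>+ x\<in>C. \<Psi> x \<partial>M)"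
    and pos': "AE x in M. x \<in> B \<longrightarrow> 0 < \<Psi> x"
    using g unfolding rn_map_def by blast
  have A: "A \<in> sets M" and fm: "f \<in> measurable (restrict_space M A) M"
    and B: "B \<in> sets M" and gm: "g \<in> measurable (restrict_space M B) M"
    using f g by (auto simp: rn_map_def)
  let ?C = "{x\<in>A. f x \<in> B}"
  have spA: "space (restrict_space M A) = A"
    using sets.sets_into_space[OF A] by (auto simp: space_restrict_space)
  have "f -` B \<inter> A \<in> sets M"
    using measurable_sets[OF fm B] A spA by (simp add: sets_restrict_space_iff)
  moreover have "f -` B \<inter> A = ?C" by auto
  ultimately have C: "?C \<in> sets M" by simp
  have fC: "f \<in> measurable (restrict_space M ?C) (restrict_space M B)"
    using measurable_restrict_mono[OF fm, of ?C]
    by (intro measurable_restrict_space2) (auto simp: space_restrict_space)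
  have gf: "(\<lambda>x. g (f x)) \<in> measurable (restrict_space M ?C) M"
    using measurable_compose[OF fC gm] .
  \<comment> \<open>\<open>f\<close> is measurable only on \<open>A\<close>; the indicator extends
    \<open>\<Psi> (f x)\<close> by zero, which makes the density measurable on all of
    \<open>M\<close>.\<close>
  let ?T = "\<lambda>x. \<Psi> (f x) * indicator A x * \<Phi> x"
  have "(\<lambda>x. \<Psi> (f x)) \<in> borel_measurable (restrict_space M A)"
    using measurable_compose[OF fm \<Psi>] .
  then have "(\<lambda>x. \<Psi> (f x) * indicator A x) \<in> borel_measurable M"
    using A by (subst (asm) borel_measurable_restrict_space_iff_ennreal) auto
  then have T: "?T \<in> borel_measurable M"
    using \<Phi> by (rule borel_measurable_times_ennreal)
  have "(\<lambda>x. g (f x)) ` E \<in> sets M \<and> emeasure M ((\<lambda>x. g (f x)) ` E) = (\<integral>\<^sup>+ x\<in>E. ?T x \<partial>M)"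
    if E: "E \<in> sets M" "E \<subseteq> ?C" for E
  proof -
    have EA: "E \<subseteq> A" and fE: "f ` E \<subseteq> B" using E by auto
    have fEs: "f ` E \<in> sets M" using im E EA by blast
    have "(\<integral>\<^sup>+ y\<in>f ` E. \<Psi> y \<partial>M) = (\<integral>\<^sup>+ x\<in>E. (\<Psi> (f x) * \<Phi> x) \<partial>M)"
      using nn_integral_image[OF A fm \<Phi> im \<Psi> E(1) EA] .
    also have "\<dots> = (\<integral>\<^sup>+ x\<in>E. ?T x \<partial>M)"
      using EA by (intro nn_integral_cong) (auto simp: indicator_def)
    finally show ?thesis using im'[OF fEs fE] by (simp add: image_image)
  qed
  moreover have "AE x in M. x \<in> ?C \<longrightarrow> 0 < ?T x"
    using pos rn_map_AE_pullback[OF f pos']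
    by eventually_elim (auto simp: ennreal_zero_less_mult_iff)
  ultimately show ?thesis
    unfolding rn_map_def using C gf by (intro conjI bexI[OF _ T]) auto
qed

section \<open>Null-set conditions as almost-everywhere statements\<close>

lemma emeasure_Diff_eq_0_iff_AE:
  assumes "A \<in> sets M" "B \<in> sets M"
  shows "emeasure M (A - B) = 0 \<longleftrightarrow> (AE z in M. z \<in> A \<longrightarrow> z \<in> B)"
proof -
  have "(AE z in M. z \<in> A \<longrightarrow> z \<in> B) \<longleftrightarrow> (AE z in M. z \<notin> A - B)"
    by (rule AE_cong) auto
  also have "\<dots> \<longleftrightarrow> A - B \<in> null_sets M"
    using assms by (subst AE_iff_null_sets) auto
  finally show ?thesis using assms by auto
qed

lemma emeasure_Int_eq_0_iff_AE:
  assumes "A \<in> sets M" "B \<in> sets M"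
  shows "emeasure M (A \<inter> B) = 0 \<longleftrightarrow> (AE z in M. z \<notin> A \<or> z \<notin> B)"
proof -
  have "(AE z in M. z \<notin> A \<or> z \<notin> B) \<longleftrightarrow> (AE z in M. z \<notin> A \<inter> B)"
    by (rule AE_cong) auto
  also have "\<dots> \<longleftrightarrow> A \<inter> B \<in> null_sets M"
    using assms by (subst AE_iff_null_sets) auto
  finally show ?thesis using assms by auto
qed

section \<open>Edge paths in a k-graph\<close>

lemma ex1_eqI: "\<exists>!x. P x \<Longrightarrow> P a \<Longrightarrow> P b \<Longrightarrow> a = b"
  by blast

section \<open>Degree vectors and the canonical sequence of directions\<close>

lemma sum_list_fun_apply:
  fixes fs :: "('a \<Rightarrow> 'b::monoid_add) list"
  shows "sum_list fs j = sum_list (map (\<lambda>f. f j) fs)"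
  by (induction fs) auto

lemma unit_vec_neq_0: "unit_vec i \<noteq> 0"
  by (auto simp: unit_vec_def fun_eq_iff)

lemma unit_vec_inject [simp]: "unit_vec i = unit_vec j \<longleftrightarrow> i = j"
  by (metis unit_vec_def zero_neq_one)

text \<open>Directions instead of degree vectors: one word then indexes both the edges of a
  canonical path and the coding maps that undo them.\<close>

definition canon_indices :: "nat \<Rightarrow> (nat \<Rightarrow> nat) \<Rightarrow> nat list" where
  "canon_indices k m = concat (map (\<lambda>i. replicate (m i) i) (rev [0..<k]))"

lemma canon_degs_eq: "canon_degs k m = map unit_vec (canon_indices k m)"
  by (simp add: canon_degs_def canon_indices_def map_concat comp_def)

lemma set_canon_indices: "set (canon_indices k m) \<subseteq> {..<k}"
  by (auto simp: canon_indices_def)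

lemma canon_indices_Suc:
  "canon_indices (Suc k) m = replicate (m k) k @ canon_indices k m"
  by (simp add: canon_indices_def)

lemma sum_list_canon_degs:
  assumes "in_Nk k m"
  shows "sum_list (canon_degs k m) = m"
proof -
  have "sum_list (canon_degs k m) j = (if j < k then m j else 0)" for j
    unfolding canon_degs_eq
    by (induction k)
       (auto simp: canon_indices_Suc canon_indices_def[of 0] sum_list_fun_apply unit_vec_def
          sum_list_replicate comp_def less_Suc_eq)
  then show ?thesis using assms by (auto simp: in_Nk_def fun_eq_iff)
qed

lemma canon_degs_0: "canon_degs k 0 = []"
  by (simp add: canon_degs_def)

lemma canon_indices_unit_vec:
  "i < k \<Longrightarrow> canon_indices k (unit_vec i) = [i]"
proof (induction k)
  case (Suc k)
  have "canon_indices n (unit_vec i) = []" if "n \<le> i" for n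
    using that by (auto simp: canon_indices_def unit_vec_def)
  with Suc show ?case by (auto simp: canon_indices_Suc less_Suc_eq) (auto simp: unit_vec_def)
qed simp

text \<open>\<open>foldr\<close> over \<open>[0..<k]\<close> applies the powers of the largest
  direction first, and \<open>canon_indices\<close> lists that direction first, so
  \<open>fold\<close> performs the same steps in the same order.\<close>

lemma ext_cod_eq_fold:
  "ext_cod k c m x = fold c (canon_indices k m) x"
proof -
  have "fold c (replicate n i) y = (c i ^^ n) y" for n i y
    by (induction n arbitrary: y) (auto simp: funpow_swap1)
  then show ?thesis
    unfolding ext_cod_def
    by (induction k arbitrary: x) (auto simp: canon_indices_Suc canon_indices_def[of 0])
qed

locale k_graph =
  fixes k :: nat and Lam :: "'a set" and r s :: "'a \<Rightarrow> 'a" and cmp :: "'a \<Rightarrow> 'a \<Rightarrow> 'a"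
    and d :: "'a \<Rightarrow> nat \<Rightarrow> nat"
  assumes kgraph: "kgraph k Lam r s cmp d"
begin

lemma in_Nk_degree: "x \<in> Lam \<Longrightarrow> in_Nk k (d x)"
  and range_in [simp]: "x \<in> Lam \<Longrightarrow> r x \<in> Lam"
  and source_in [simp]: "x \<in> Lam \<Longrightarrow> s x \<in> Lam"
  and degree_range [simp]: "x \<in> Lam \<Longrightarrow> d (r x) = 0"
  and degree_source [simp]: "x \<in> Lam \<Longrightarrow> d (s x) = 0"
  and range_vertex: "x \<in> Lam \<Longrightarrow> d x = 0 \<Longrightarrow> r x = x"
  and source_vertex: "x \<in> Lam \<Longrightarrow> d x = 0 \<Longrightarrow> s x = x"
  and cmp_range_left [simp]: "x \<in> Lam \<Longrightarrow> cmp (r x) x = x"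
  and cmp_source_right [simp]: "x \<in> Lam \<Longrightarrow> cmp x (s x) = x"
  and cmp_in: "x \<in> Lam \<Longrightarrow> y \<in> Lam \<Longrightarrow> s x = r y \<Longrightarrow> cmp x y \<in> Lam"
  and range_cmp: "x \<in> Lam \<Longrightarrow> y \<in> Lam \<Longrightarrow> s x = r y \<Longrightarrow> r (cmp x y) = r x"
  and source_cmp: "x \<in> Lam \<Longrightarrow> y \<in> Lam \<Longrightarrow> s x = r y \<Longrightarrow> s (cmp x y) = s y"
  and degree_cmp: "x \<in> Lam \<Longrightarrow> y \<in> Lam \<Longrightarrow> s x = r y \<Longrightarrow> d (cmp x y) = d x + d y"
  and cmp_assoc: "x \<in> Lam \<Longrightarrow> y \<in> Lam \<Longrightarrow> z \<in> Lam \<Longrightarrow> s x = r y \<Longrightarrow> s y = r z \<Longrightarrow>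
        cmp (cmp x y) z = cmp x (cmp y z)"
  using kgraph unfolding kgraph_def by meson+

lemma factorization_ex1:
  assumes "x \<in> Lam" "d x = m + n"
  shows "\<exists>!p. fst p \<in> Lam \<and> snd p \<in> Lam \<and> s (fst p) = r (snd p) \<and>
              cmp (fst p) (snd p) = x \<and> d (fst p) = m \<and> d (snd p) = n"
proof -
  have "\<forall>x\<in>Lam. \<forall>m n. d x = m + n \<longrightarrow>
        (\<exists>!p. fst p \<in> Lam \<and> snd p \<in> Lam \<and> s (fst p) = r (snd p) \<and>
              cmp (fst p) (snd p) = x \<and> d (fst p) = m \<and> d (snd p) = n)"
    using kgraph unfolding kgraph_def by (elim conjE)
  then show ?thesis using assms by blast
qed

lemma factorization:
  assumes "x \<in> Lam" "d x = m + n"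
  obtains p q where "p \<in> Lam" "q \<in> Lam" "s p = r q" "cmp p q = x" "d p = m" "d q = n"
  using factorization_ex1[OF assms] by blast

text \<open>Only the degrees of the first factors are compared; those of the second factors agree by
  cancellation.\<close>

lemma factorization_unique:
  assumes pq: "p \<in> Lam" "q \<in> Lam" "s p = r q" and pq': "p' \<in> Lam" "q' \<in> Lam" "s p' = r q'"
    and eq: "cmp p q = cmp p' q'" and deg: "d p = d p'"
  shows "p = p' \<and> q = q'"
proof -
  have "d p + d q = d p' + d q'"
    using degree_cmp[OF pq] degree_cmp[OF pq'] eq by simp
  then have dq: "d q = d q'" using deg by simp
  have "(p, q) = (p', q')"
    using pq pq' eq deg dq
    by (intro ex1_eqI[OF factorization_ex1[OF cmp_in[OF pq] degree_cmp[OF pq]]]) auto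
  then show ?thesis by simp
qed

section \<open>Factorizations of morphisms into edges\<close>

abbreviation "edge e \<equiv> e \<in> Lam \<and> is_edge k d e"

text \<open>The composite is carried along with the list, and the empty list is a path at each
  vertex, whereas \<open>list_comp\<close> is \<open>undefined\<close> there. Inductions can
  therefore start at vertices.\<close>

inductive edge_path :: "'a \<Rightarrow> 'a list \<Rightarrow> bool" where
  Nil: "v \<in> Lam \<Longrightarrow> d v = 0 \<Longrightarrow> edge_path v []"
| Cons: "edge e \<Longrightarrow> edge_path \<eta> es \<Longrightarrow> s e = r \<eta> \<Longrightarrow> edge_path (cmp e \<eta>) (e # es)"

lemma edge_pathD:
  assumes "edge_path \<eta> es"
  shows "\<eta> \<in> Lam" "d \<eta> = sum_list (map d es)" "\<And>e. e \<in> set es \<Longrightarrow> edge e"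
  using assms by (induction) (auto simp: cmp_in degree_cmp)

lemma edge_path_ConsE:
  assumes "edge_path \<eta> (e # es)"
  obtains \<eta>' where "edge e" "edge_path \<eta>' es" "\<eta>' \<in> Lam" "s e = r \<eta>'" "\<eta> = cmp e \<eta>'" "r \<eta> = r e" "s \<eta> = s \<eta>'"
  using assms
proof cases
  case (Cons \<eta>')
  then show ?thesis using that[of \<eta>'] edge_pathD(1)[of \<eta>' es] range_cmp source_cmp by blast
qed

lemma edge_path_append:
  assumes "edge_path \<eta> es" "edge_path \<zeta> fs" "s \<eta> = r \<zeta>"
  shows "edge_path (cmp \<eta> \<zeta>) (es @ fs)"
  using assms
proof (induction es arbitrary: \<eta> rule: list.induct)
  case Nil
  then have "\<eta> \<in> Lam" "d \<eta> = 0" using edge_pathD[OF Nil(1)] by simp_all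
  then have "\<eta> = r \<zeta>" using source_vertex Nil by metis
  then show ?case using Nil edge_pathD(1) by simp
next
  case (Cons e es)
  from Cons.prems(1) show ?case
  proof (cases rule: edge_path_ConsE)
    case (1 \<eta>')
    then have "edge_path (cmp e (cmp \<eta>' \<zeta>)) (e # es @ fs)"
      using Cons edge_pathD(1)[OF Cons.prems(2)] by (intro edge_path.Cons) (auto simp: range_cmp)
    moreover have "cmp e (cmp \<eta>' \<zeta>) = cmp \<eta> \<zeta>"
      using 1 Cons.prems edge_pathD(1)[OF Cons.prems(2)] by (simp add: cmp_assoc)
    ultimately show ?thesis by simp
  qed
qed

text \<open>Unique factorization splits off one edge per direction, in any prescribed order of the
  directions.\<close>

lemma edge_path_exists:
  assumes "\<eta> \<in> Lam" "d \<eta> = sum_list (map unit_vec is)" "set is \<subseteq> {..<k}"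
  shows "\<exists>es. edge_path \<eta> es \<and> map d es = map unit_vec is"
  using assms
proof (induction "is" arbitrary: \<eta>)
  case Nil
  then show ?case by (intro exI[of _ "[]"] conjI edge_path.Nil) (simp_all add: zero_fun_def)
next
  case (Cons i "is")
  then have "d \<eta> = unit_vec i + sum_list (map unit_vec is)" by (simp add: plus_fun_def)
  then obtain p q where pq: "p \<in> Lam" "q \<in> Lam" "s p = r q" "cmp p q = \<eta>" "d p = unit_vec i"
    "d q = sum_list (map unit_vec is)"
    using factorization[OF Cons.prems(1)] by metis
  then obtain es where es: "edge_path q es" "map d es = map unit_vec is"
    using Cons by auto
  then have "edge_path \<eta> (p # es)"
    using edge_path.Cons[of p q es] pq Cons.prems(3) by (auto simp: is_edge_def)
  with es pq show ?case by (intro exI[of _ "p # es"]) auto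
qed

lemma edge_path_unique:
  "edge_path \<eta> es \<Longrightarrow> edge_path \<eta> fs \<Longrightarrow> map d es = map d fs \<Longrightarrow> es = fs"
proof (induction es arbitrary: \<eta> fs)
  case (Cons e es)
  then obtain f fs' where fs: "fs = f # fs'" by auto
  obtain \<eta>' where \<eta>': "edge e" "edge_path \<eta>' es" "\<eta>' \<in> Lam" "s e = r \<eta>'" "\<eta> = cmp e \<eta>'"
    using edge_path_ConsE[OF Cons.prems(1)] by metis
  obtain \<eta>'' where \<eta>'': "edge f" "edge_path \<eta>'' fs'" "\<eta>'' \<in> Lam" "s f = r \<eta>''" "\<eta> = cmp f \<eta>''"
    using edge_path_ConsE[OF Cons.prems(2)[unfolded fs]] by metis
  have "e = f \<and> \<eta>' = \<eta>''"
    using \<eta>' \<eta>'' Cons.prems(3) fs by (intro factorization_unique) auto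
  then show ?case using Cons.IH \<eta>' \<eta>'' Cons.prems(3) fs by auto
qed simp

text \<open>Each edge has total degree one. Hence all edge paths of a morphism are equally long,
  which permits induction on the length for pairs of paths.\<close>

lemma edge_path_length:
  assumes "edge_path \<eta> es"
  shows "length es = (\<Sum>i<k. d \<eta> i)"
  using assms
proof induction
  case (Cons e \<eta> es)
  have "(\<Sum>i<k. d e i) = 1"
    using Cons(1) by (auto simp: is_edge_def unit_vec_def)
  then show ?case using Cons edge_pathD(1) by (simp add: degree_cmp sum.distrib)
qed simp

text \<open>Link to the functions used in the definitions. The single edge is the delicate case: the
  inductive description composes it with the vertex at its source.\<close>

lemma edge_path_iff_list_comp:
  assumes "es \<noteq> []"
  shows "edge_path \<eta> es \<longleftrightarrow>
    (\<forall>e\<in>set es. edge e) \<and> path_chain s r es \<and> list_comp cmp es = \<eta>"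
  using assms
proof (induction es arbitrary: \<eta>)
  case (Cons e es)
  show ?case
  proof (cases es)
    case Nil
    have "edge_path \<eta> [e] \<longleftrightarrow> edge e \<and> e = \<eta>"
    proof
      assume "edge_path \<eta> [e]"
      then show "edge e \<and> e = \<eta>"
      proof (cases rule: edge_path_ConsE)
        case (1 \<eta>')
        have "d \<eta>' = 0" using edge_pathD(2)[OF 1(2)] by (simp add: zero_fun_def)
        then have "\<eta>' = s e" using range_vertex[OF 1(3)] 1(4) by simp
        then have "cmp e \<eta>' = e" using 1(1) by simp
        with 1(1,5) show ?thesis by simp
      qed
    next
      assume "edge e \<and> e = \<eta>"
      then show "edge_path \<eta> [e]"
        using edge_path.Cons[of e "s e" "[]"] edge_path.Nil[of "s e"] by (auto simp: range_vertex)
    qed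
    then show ?thesis using Nil by simp
  next
    case (Cons f fs)
    have IH: "edge_path \<zeta> es \<longleftrightarrow>
      (\<forall>e\<in>set es. edge e) \<and> path_chain s r es \<and> list_comp cmp es = \<zeta>" for \<zeta>
      using Cons.IH Cons by simp
    have rng: "r \<zeta> = r f" if "edge_path \<zeta> es" for \<zeta>
      using that unfolding Cons by (elim edge_path_ConsE)
    show ?thesis
    proof
      assume "edge_path \<eta> (e # es)"
      then show "(\<forall>e\<in>set (e # es). edge e) \<and> path_chain s r (e # es) \<and> list_comp cmp (e # es) = \<eta>"
        using IH rng Cons by (elim edge_path_ConsE) auto
    next
      assume R: "(\<forall>e\<in>set (e # es). edge e) \<and> path_chain s r (e # es) \<and> list_comp cmp (e # es) = \<eta>"
      then have "edge_path (list_comp cmp es) es" using IH Cons by auto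
      with R rng[OF this] show "edge_path \<eta> (e # es)"
        using edge_path.Cons[of e "list_comp cmp es" es] Cons by auto
    qed
  qed
qed simp

text \<open>Vertices are given the empty path, which makes \<^const>\<open>ext_tau\<close> a fold in every degree.\<close>

definition canon :: "'a \<Rightarrow> 'a list" where
  "canon \<eta> = (if d \<eta> = 0 then [] else canon_path k Lam r s cmp d \<eta>)"

text \<open>The predicate behind the choice says exactly that the list is an edge path with the
  canonical degrees, so \<open>edge_path_exists\<close> makes the choice succeed.\<close>

lemma canon_path_spec:
  assumes "\<eta> \<in> Lam" "d \<eta> \<noteq> 0"
  shows "edge_path \<eta> (canon_path k Lam r s cmp d \<eta>) \<and>
    map d (canon_path k Lam r s cmp d \<eta>) = canon_degs k (d \<eta>) \<and>
    canon_path k Lam r s cmp d \<eta> \<noteq> []"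
proof -
  let ?P = "\<lambda>es. set es \<subseteq> Lam \<and> path_chain s r es \<and> map d es = canon_degs k (d \<eta>) \<and>
               list_comp cmp es = \<eta>"
  have sum: "sum_list (canon_degs k (d \<eta>)) = d \<eta>"
    using sum_list_canon_degs[OF in_Nk_degree[OF assms(1)]] .
  have iff: "?P es \<longleftrightarrow> edge_path \<eta> es \<and> map d es = canon_degs k (d \<eta>)" for es
  proof (cases "map d es = canon_degs k (d \<eta>)")
    case True
    then have ne: "es \<noteq> []" using sum assms by auto
    have "is_edge k d e" if "e \<in> set es" for e
    proof -
      have "d e \<in> set (map d es)" using that by simp
      then show ?thesis
        using set_canon_indices[of k "d \<eta>"] unfolding True canon_degs_eq by (auto simp: is_edge_def)
    qed
    then show ?thesis unfolding edge_path_iff_list_comp[OF ne] using True by auto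
  qed auto
  have "\<exists>es. ?P es"
    using edge_path_exists[OF assms(1), of "canon_indices k (d \<eta>)"] sum set_canon_indices
    unfolding iff by (simp add: canon_degs_eq)
  then have "?P (canon_path k Lam r s cmp d \<eta>)"
    unfolding canon_path_def by (rule someI_ex)
  then show ?thesis unfolding iff using sum assms(2) by auto
qed

lemma edge_path_canon: "\<eta> \<in> Lam \<Longrightarrow> edge_path \<eta> (canon \<eta>)"
  using canon_path_spec by (auto simp: canon_def intro: edge_path.Nil)

lemma degrees_canon: "\<eta> \<in> Lam \<Longrightarrow> map d (canon \<eta>) = canon_degs k (d \<eta>)"
  using canon_path_spec by (auto simp: canon_def canon_degs_0)

lemma canon_eq_Nil_iff: "\<eta> \<in> Lam \<Longrightarrow> canon \<eta> = [] \<longleftrightarrow> d \<eta> = 0"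
  using canon_path_spec by (auto simp: canon_def)

text \<open>The list \<open>[e]\<close> already has the canonical degrees, so uniqueness applies.
  Hence the extended maps agree with the given ones on edges.\<close>

lemma canon_edge:
  assumes "edge e"
  shows "canon e = [e]"
proof -
  obtain i where i: "i < k" "d e = unit_vec i" using assms by (auto simp: is_edge_def)
  have "map d (canon e) = [unit_vec i]"
    using degrees_canon[of e] assms i by (simp add: canon_degs_eq canon_indices_unit_vec)
  moreover have "edge_path e [e]"
    using assms by (subst edge_path_iff_list_comp) auto
  ultimately show ?thesis
    using edge_path_unique[of e "canon e" "[e]"] edge_path_canon[of e] assms i by simp
qed

lemma ext_tau_eq: "ext_tau k Lam r s cmp d \<tau> \<eta> x = foldr \<tau> (canon \<eta>) x"
  by (simp add: ext_tau_def canon_def)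

lemma ext_dom_eq:
  "ext_dom k Lam r s cmp d D \<tau> \<eta> = (if d \<eta> = 0 then vertex_dom k Lam s d D \<eta> else path_dom D \<tau> (canon \<eta>))"
  by (simp add: ext_dom_def canon_def)

end

section \<open>Prefixing and coding maps generated by edges\<close>

locale edge_system = k_graph k Lam r s cmp d
  for k :: nat and Lam :: "'a set" and r s :: "'a \<Rightarrow> 'a" and cmp :: "'a \<Rightarrow> 'a \<Rightarrow> 'a"
    and d :: "'a \<Rightarrow> nat \<Rightarrow> nat" +
  fixes M :: "'x measure" and D :: "'a \<Rightarrow> 'x set" and \<tau> :: "'a \<Rightarrow> 'x \<Rightarrow> 'x" and c :: "nat \<Rightarrow> 'x \<Rightarrow> 'x"
  assumes k_pos: "0 < k"
    and finite_degree: "finite {x\<in>Lam. d x = m}"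
    and sbfs_edges: "i < k \<Longrightarrow> sbfs M {x\<in>Lam. d x = unit_vec i} D \<tau>"
    and coding_edges: "i < k \<Longrightarrow> coding_map M {x\<in>Lam. d x = unit_vec i} D \<tau> (c i)"
begin

abbreviation "V \<equiv> vertex_dom k Lam s d D"
abbreviation "PD \<equiv> path_dom D \<tau>"
abbreviation "ED \<equiv> ext_dom k Lam r s cmp d D \<tau>"
abbreviation "ET \<equiv> ext_tau k Lam r s cmp d \<tau>"

lemma edgeE:
  assumes "edge e"
  obtains i where "i < k" "d e = unit_vec i"
  using assms by (auto simp: is_edge_def)

lemma edgeI: "e \<in> Lam \<Longrightarrow> d e = unit_vec i \<Longrightarrow> i < k \<Longrightarrow> edge e"
  by (auto simp: is_edge_def)

lemma edge_degree_neq_0: "edge e \<Longrightarrow> d e \<noteq> 0"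
  using unit_vec_neq_0 by (auto elim!: edgeE)

lemma edge_rn_map:
  assumes "edge e"
  shows "rn_map M (D e) (\<tau> e)"
proof -
  obtain i where "i < k" "d e = unit_vec i" using assms by (rule edgeE)
  then show ?thesis using sbfs_edges[of i] assms by (simp add: sbfs_iff_rn_map)
qed

lemma edge_dom_sets: "edge e \<Longrightarrow> D e \<in> sets M"
  using edge_rn_map rn_map_sets by blast

lemma edge_range_sets: "edge e \<Longrightarrow> \<tau> e ` D e \<in> sets M"
  using edge_rn_map rn_map_image_sets by blast

lemma finite_edges: "finite {x\<in>Lam. is_edge k d x \<and> Q x}"
proof -
  have "{x\<in>Lam. is_edge k d x \<and> Q x} \<subseteq> (\<Union>i<k. {x\<in>Lam. d x = unit_vec i})"
    by (auto simp: is_edge_def)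
  then show ?thesis by (rule finite_subset) (auto simp: finite_degree)
qed

lemma vertex_dom_sets: "V v \<in> sets M"
  unfolding vertex_dom_def using edge_dom_sets finite_edges by (intro sets.finite_UN) auto

lemma edge_dom_subset: "edge e \<Longrightarrow> D e \<subseteq> V (s e)"
  by (auto simp: vertex_dom_def)

lemma coding_edge:
  assumes "e \<in> Lam" "d e = unit_vec i" "i < k" "x \<in> D e"
  shows "c i (\<tau> e x) = x"
  using coding_edges[of i] assms by (auto simp: coding_map_def)

lemma edge_inj:
  assumes "edge e" "x \<in> D e" "y \<in> D e" "\<tau> e x = \<tau> e y"
  shows "x = y"
  using assms coding_edge by (metis edgeE)

text \<open>The intersection with \<open>space M\<close> is there because the empty path has domain
  \<open>UNIV\<close>.\<close>

lemma path_rn_map: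
  "(\<And>e. e \<in> set es \<Longrightarrow> edge e) \<Longrightarrow> rn_map M (PD es \<inter> space M) (foldr \<tau> es)"
proof (induction es)
  case Nil
  have "rn_map M (space M) (\<lambda>x. x)" by (rule rn_map_id) simp
  then show ?case by (simp add: id_def)
next
  case (Cons e es)
  have "rn_map M {x \<in> PD es \<inter> space M. foldr \<tau> es x \<in> D e} (\<lambda>x. \<tau> e (foldr \<tau> es x))"
    using Cons by (intro rn_map_comp edge_rn_map) auto
  moreover have "{x \<in> PD es \<inter> space M. foldr \<tau> es x \<in> D e} = PD (e # es) \<inter> space M" by auto
  ultimately show ?case by (simp add: comp_def)
qed

text \<open>The last edge acts first and has source \<open>s \<eta>\<close>, so its domain bounds
  that of the whole path.\<close>

lemma path_dom_subset:
  "edge_path \<eta> es \<Longrightarrow> es \<noteq> [] \<Longrightarrow> PD es \<subseteq> V (s \<eta>)"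
proof (induction es arbitrary: \<eta> rule: list.induct)
  case (Cons e es)
  obtain \<eta>' where \<eta>': "edge e" "edge_path \<eta>' es" "\<eta>' \<in> Lam" "s e = r \<eta>'" "s \<eta> = s \<eta>'"
    using edge_path_ConsE[OF Cons.prems(1)] by metis
  show ?case
  proof (cases "es = []")
    case True
    then have "d \<eta>' = 0" using edge_pathD(2)[OF \<eta>'(2)] by (simp add: zero_fun_def)
    then have "s \<eta> = s e" using \<eta>' range_vertex source_vertex by metis
    then show ?thesis using True edge_dom_subset[OF \<eta>'(1)] by auto
  next
    case False
    then show ?thesis using Cons.IH[OF \<eta>'(2)] \<eta>' by auto
  qed
qed simp

lemma ext_dom_subset: "\<eta> \<in> Lam \<Longrightarrow> ED \<eta> \<subseteq> V (s \<eta>)"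
  using path_dom_subset[OF edge_path_canon] canon_eq_Nil_iff source_vertex
  by (auto simp: ext_dom_eq)

lemma vertex_dom_space: "V v \<subseteq> space M"
  using vertex_dom_sets sets.sets_into_space by blast

lemma ext_rn_map:
  assumes "\<eta> \<in> Lam"
  shows "rn_map M (ED \<eta>) (ET \<eta>)"
proof (cases "d \<eta> = 0")
  case True
  have "rn_map M (V \<eta>) (\<lambda>x. x)" using vertex_dom_sets by (rule rn_map_id)
  then show ?thesis using True by (simp add: ext_dom_def ext_tau_def[abs_def])
next
  case False
  \<comment> \<open>Cutting with \<open>space M\<close> changes nothing here, since the domain lies
    in the measurable set \<open>V (s \<eta>)\<close>.\<close>
  have "ED \<eta> = PD (canon \<eta>) \<inter> space M"
    using ext_dom_subset[OF assms] vertex_dom_space False by (auto simp: ext_dom_eq)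
  moreover have "ET \<eta> = foldr \<tau> (canon \<eta>)" by (simp add: ext_tau_eq fun_eq_iff)
  ultimately show ?thesis
    using path_rn_map[of "canon \<eta>"] edge_pathD(3)[OF edge_path_canon[OF assms]] by simp
qed

lemma ext_dom_sets: "\<eta> \<in> Lam \<Longrightarrow> ED \<eta> \<in> sets M"
  using ext_rn_map rn_map_sets by blast

lemma ext_range_sets: "\<eta> \<in> Lam \<Longrightarrow> ET \<eta> ` ED \<eta> \<in> sets M"
  using ext_rn_map rn_map_image_sets by blast

text \<open>The head of the list is the outermost prefixing map and \<open>fold\<close> applies the
  head index first, so edges are removed from left to right.\<close>

lemma fold_coding_path:
  assumes "\<And>e. e \<in> set es \<Longrightarrow> edge e" "map d es = map unit_vec is" "x \<in> PD es"
  shows "fold c is (foldr \<tau> es x) = x"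
  using assms
proof (induction es arbitrary: "is")
  case (Cons e es)
  then obtain i is' where i: "is = i # is'" "d e = unit_vec i" "map d es = map unit_vec is'"
    by auto
  have "i < k" using Cons.prems(1)[of e] i by (auto simp: is_edge_def)
  then have "c i (\<tau> e (foldr \<tau> es x)) = foldr \<tau> es x"
    using Cons.prems i by (intro coding_edge) auto
  moreover have "fold c is' (foldr \<tau> es x) = x"
    using Cons i by auto
  ultimately show ?case by (simp add: i)
qed simp

lemma coding_ext:
  assumes "\<eta> \<in> Lam" "x \<in> ED \<eta>"
  shows "ext_cod k c (d \<eta>) (ET \<eta> x) = x"
proof -
  have "x \<in> PD (canon \<eta>)"
    using assms canon_eq_Nil_iff[OF assms(1)] by (auto simp: ext_dom_eq split: if_splits)
  then show ?thesis
    unfolding ext_cod_eq_fold ext_tau_eq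
    using edge_pathD(3)[OF edge_path_canon[OF assms(1)]] degrees_canon[OF assms(1)]
    by (intro fold_coding_path) (auto simp: canon_degs_eq)
qed

lemma coding_measurable: "i < k \<Longrightarrow> c i \<in> measurable M M"
  using coding_edges by (auto simp: coding_map_def)

lemma coding_space: "i < k \<Longrightarrow> z \<in> space M \<Longrightarrow> c i z \<in> space M"
  using coding_measurable by (auto simp: measurable_def)

lemma fold_coding_measurable:
  "set is \<subseteq> {..<k} \<Longrightarrow> fold c is \<in> measurable M M"
proof (induction "is")
  case (Cons i "is")
  then show ?case using coding_measurable[of i] by (auto intro: measurable_comp)
qed (simp add: id_def)

lemma ext_cod_measurable: "ext_cod k c m \<in> measurable M M"
proof -
  have "ext_cod k c m = fold c (canon_indices k m)"
    by (simp add: fun_eq_iff ext_cod_eq_fold)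
  then show ?thesis using fold_coding_measurable[OF set_canon_indices] by simp
qed

text \<open>At the first difference stand two edges of equal degree, whose ranges are essentially
  disjoint; the common initial edges preserve this because they are injective and map null sets to
  null sets.\<close>

lemma path_ranges_disjoint:
  assumes "\<And>e. e \<in> set es \<union> set fs \<Longrightarrow> edge e" "map d es = map d fs" "es \<noteq> fs"
  shows "AE z in M. z \<notin> foldr \<tau> es ` PD es \<or> z \<notin> foldr \<tau> fs ` PD fs"
  using assms
proof (induction es arbitrary: fs)
  case (Cons e es)
  then obtain f fs' where fs: "fs = f # fs'" "d e = d f" "map d es = map d fs'"
    by (cases fs) auto
  have e: "edge e" and f: "edge f" using Cons.prems(1) fs by auto
  have sub: "foldr \<tau> (e # es) ` PD (e # es) \<subseteq> \<tau> e ` (foldr \<tau> es ` PD es \<inter> D e)"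
    "foldr \<tau> (f # fs') ` PD (f # fs') \<subseteq> \<tau> f ` (foldr \<tau> fs' ` PD fs' \<inter> D f)" by auto
  show ?case
  proof (cases "e = f")
    case True
    then have "AE z in M. z \<notin> foldr \<tau> es ` PD es \<or> z \<notin> foldr \<tau> fs' ` PD fs'"
      using Cons fs by (intro Cons.IH) auto
    then have "AE x in M. x \<in> D e \<longrightarrow>
       (\<tau> e x \<notin> \<tau> e ` (foldr \<tau> es ` PD es \<inter> D e) \<or> \<tau> e x \<notin> \<tau> e ` (foldr \<tau> fs' ` PD fs' \<inter> D e))"
      by eventually_elim (use edge_inj[OF e] in blast)
    then have "AE y in M. y \<in> \<tau> e ` D e \<longrightarrow>
       (y \<notin> \<tau> e ` (foldr \<tau> es ` PD es \<inter> D e) \<or> y \<notin> \<tau> e ` (foldr \<tau> fs' ` PD fs' \<inter> D e))"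
      using rn_map_AE_image[OF edge_rn_map[OF e]] by simp
    then show ?thesis
      unfolding fs(1) by eventually_elim (use sub True in blast)
  next
    case False
    obtain i where i: "i < k" "d e = unit_vec i" using e by (rule edgeE)
    have "emeasure M (\<tau> e ` D e \<inter> \<tau> f ` D f) = 0"
      using sbfs_edges[OF i(1)] i fs(2) e f False by (simp add: sbfs_iff_rn_map)
    then have "AE z in M. z \<notin> \<tau> e ` D e \<or> z \<notin> \<tau> f ` D f"
      using edge_range_sets e f by (simp add: emeasure_Int_eq_0_iff_AE)
    then show ?thesis
      unfolding fs(1) by eventually_elim (use sub in blast)
  qed
qed simp

lemma ext_edge:
  assumes "edge e"
  shows "ED e = D e" "ET e x = \<tau> e x"
  using canon_edge[OF assms] edge_degree_neq_0[OF assms]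
  by (auto simp: ext_dom_eq ext_tau_eq)

lemma ext_edge_range: "edge e \<Longrightarrow> ET e ` ED e = \<tau> e ` D e"
  by (simp add: ext_edge)

lemma ext_vertex:
  assumes "d v = 0"
  shows "ED v = V v" "ET v x = x"
  using assms by (auto simp: ext_dom_def ext_tau_def)

lemma ext_vertex_range: "d v = 0 \<Longrightarrow> ET v ` ED v = V v"
  by (simp add: ext_vertex)

lemma ext_cod_unit_vec: "i < k \<Longrightarrow> ext_cod k c (unit_vec i) x = c i x"
  by (simp add: ext_cod_eq_fold canon_indices_unit_vec)

end

section \<open>Consequences of conditions (i) to (v)\<close>

text \<open>The conditions in almost-everywhere form. \<open>range_in_dom\<close> is stated for
  every composable pair of edges rather than for commuting squares, which is the shape the
  inductions use.\<close>

locale compatible_edge_system = edge_system +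
  assumes same_source_AE: "edge x \<Longrightarrow> edge y \<Longrightarrow> s x = s y \<Longrightarrow> AE z in M. z \<in> D x \<longrightarrow> z \<in> D y"
    and vertex_dom_pos: "v \<in> Lam \<Longrightarrow> d v = 0 \<Longrightarrow> 0 < emeasure M (vertex_dom k Lam s d D v)"
    and vertex_dom_disjoint: "v \<in> Lam \<Longrightarrow> w \<in> Lam \<Longrightarrow> d v = 0 \<Longrightarrow> d w = 0 \<Longrightarrow> v \<noteq> w \<Longrightarrow>
      AE z in M. z \<notin> vertex_dom k Lam s d D v \<or> z \<notin> vertex_dom k Lam s d D w"
    and range_in_dom: "edge x \<Longrightarrow> edge a \<Longrightarrow> s x = r a \<Longrightarrow> AE z in M. z \<in> \<tau> a ` D a \<longrightarrow> z \<in> D x"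
    and square_commutes: "edge x \<Longrightarrow> edge a \<Longrightarrow> edge y \<Longrightarrow> edge b \<Longrightarrow> d x = d b \<Longrightarrow> d y = d a \<Longrightarrow>
      s x = r a \<Longrightarrow> s y = r b \<Longrightarrow> cmp x a = cmp y b \<Longrightarrow>
      AE z in M. z \<in> D a \<inter> D b \<longrightarrow> \<tau> x (\<tau> a z) = \<tau> y (\<tau> b z)"
    and coding_commute: "i < k \<Longrightarrow> j < k \<Longrightarrow> z \<in> space M \<Longrightarrow> c i (c j z) = c j (c i z)"
    and vertex_dom_cover: "v \<in> Lam \<Longrightarrow> d v = 0 \<Longrightarrow> i < k \<Longrightarrow> AE z in M. z \<in> vertex_dom k Lam s d D v \<longrightarrow>
      (\<exists>g. g \<in> Lam \<and> d g = unit_vec i \<and> r g = v \<and> z \<in> \<tau> g ` D g)"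
begin

text \<open>\<open>V (s e)\<close> is a finite union of sets that all equal \<open>D e\<close> up to
  null sets.\<close>

lemma vertex_dom_AE:
  assumes "edge e"
  shows "AE z in M. z \<in> V (s e) \<longrightarrow> z \<in> D e"
proof -
  let ?S = "{x\<in>Lam. is_edge k d x \<and> s x = s e}"
  have "AE z in M. \<forall>x\<in>?S. z \<in> D x \<longrightarrow> z \<in> D e"
    using assms same_source_AE finite_edges by (intro AE_finite_allI) auto
  then show ?thesis by eventually_elim (auto simp: vertex_dom_def)
qed

text \<open>Positive measure makes the union \<open>V v\<close> nonempty, hence also the set of
  edges that indexes it.\<close>

lemma edge_with_source:
  assumes "v \<in> Lam" "d v = 0"
  obtains e where "edge e" "s e = v"
proof -
  have "V v \<noteq> {}" using vertex_dom_pos[OF assms] by auto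
  then show ?thesis using that by (auto simp: vertex_dom_def)
qed

lemma edge_range_in_vertex_dom:
  assumes "edge a"
  shows "AE z in M. z \<in> \<tau> a ` D a \<longrightarrow> z \<in> V (r a)"
proof -
  obtain x where x: "edge x" "s x = r a" using edge_with_source[of "r a"] assms by auto
  from range_in_dom[OF x(1) assms x(2)] show ?thesis
    by eventually_elim (use edge_dom_subset[OF x(1)] x(2) in auto)
qed

text \<open>By induction the value of the tail lies in \<open>V (s e)\<close>, which
  \<open>D e\<close> fills up to a null set; that null set is pulled back along the tail.\<close>

lemma path_defined_AE:
  assumes "edge_path \<eta> es"
  shows "AE z in M. z \<in> V (s \<eta>) \<longrightarrow> z \<in> PD es \<and> foldr \<tau> es z \<in> V (r \<eta>)"
  using assms
proof induction
  case (Nil v)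
  then show ?case by (simp add: range_vertex source_vertex)
next
  case (Cons e \<eta> es)
  have \<eta>: "\<eta> \<in> Lam" using edge_pathD(1)[OF Cons(2)] .
  have re: "r (cmp e \<eta>) = r e" "s (cmp e \<eta>) = s \<eta>" using Cons \<eta> by (auto simp: range_cmp source_cmp)
  have edges: "edge e'" if "e' \<in> set (e # es)" for e'
    using that edge_pathD(3)[OF Cons(2)] Cons(1) by auto
  have 1: "AE z in M. z \<in> PD es \<inter> space M \<longrightarrow> (foldr \<tau> es z \<in> V (s e) \<longrightarrow> foldr \<tau> es z \<in> D e)"
    using edges by (intro rn_map_AE_pullback[OF path_rn_map vertex_dom_AE]) auto
  have 2: "AE z in M. z \<in> PD (e # es) \<inter> space M \<longrightarrow>
      (foldr \<tau> (e # es) z \<in> \<tau> e ` D e \<longrightarrow> foldr \<tau> (e # es) z \<in> V (r e))"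
    using edges by (intro rn_map_AE_pullback[OF path_rn_map edge_range_in_vertex_dom]) auto
  from Cons.IH 1 2 show ?case
    unfolding re by eventually_elim (use Cons.hyps vertex_dom_space in auto)
qed

text \<open>The induction ranges over all composites and paths of a given length, because in the
  mixed case each tail is compared with a newly chosen path through a common square.\<close>

lemma edge_paths_agree_AE:
  assumes "edge_path \<eta> es" "edge_path \<eta> fs"
  shows "AE z in M. z \<in> V (s \<eta>) \<longrightarrow> foldr \<tau> es z = foldr \<tau> fs z"
  using assms
proof (induction "length es" arbitrary: \<eta> es fs)
  case 0
  then have "es = fs" using edge_path_length[OF 0(2)] edge_path_length[OF 0(3)] by simp
  then show ?case by simp
next
  case (Suc n)
  have "length fs = Suc n"
    using edge_path_length[OF Suc.prems(1)] edge_path_length[OF Suc.prems(2)] Suc(2) by simp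
  then obtain e es' f fs' where es: "es = e # es'" and fs: "fs = f # fs'"
    and len: "length es' = n" "length fs' = n"
    using Suc(2) by (metis length_Suc_conv)
  obtain \<alpha> where \<alpha>: "edge e" "edge_path \<alpha> es'" "\<alpha> \<in> Lam" "s e = r \<alpha>" "\<eta> = cmp e \<alpha>" "s \<eta> = s \<alpha>"
    using edge_path_ConsE[OF Suc.prems(1)[unfolded es]] by metis
  obtain \<beta> where \<beta>: "edge f" "edge_path \<beta> fs'" "\<beta> \<in> Lam" "s f = r \<beta>" "\<eta> = cmp f \<beta>" "s \<eta> = s \<beta>"
    using edge_path_ConsE[OF Suc.prems(2)[unfolded fs]] by metis
  show ?case
  proof (cases "d e = d f")
    case True
    have ef: "e = f \<and> \<alpha> = \<beta>"
      using \<alpha> \<beta> True by (intro factorization_unique) auto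
    then have "AE z in M. z \<in> V (s \<alpha>) \<longrightarrow> foldr \<tau> es' z = foldr \<tau> fs' z"
      using \<alpha> \<beta> len by (intro Suc.hyps(1)) auto
    then show ?thesis unfolding \<alpha>(6) es fs by eventually_elim (use ef in auto)
  next
    case False
    obtain i where i: "i < k" "d e = unit_vec i" using \<alpha>(1) by (rule edgeE)
    obtain j where j: "j < k" "d f = unit_vec j" using \<beta>(1) by (rule edgeE)
    have ij: "i \<noteq> j" using False i j by auto
    have deg: "unit_vec i + d \<alpha> = unit_vec j + d \<beta>"
      using degree_cmp[of e \<alpha>] degree_cmp[of f \<beta>] \<alpha> \<beta> i j by simp
    \<comment> \<open>What remains of the degree of \<open>\<eta>\<close> after removing
      \<open>unit_vec i\<close> and \<open>unit_vec j\<close>; the truncated subtraction is exact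
      because \<open>i \<noteq> j\<close>.\<close>
    define n' where "n' = (\<lambda>l. d \<alpha> l - unit_vec j l)"
    have \<alpha>n: "d \<alpha> = unit_vec j + n'" and \<beta>n: "d \<beta> = unit_vec i + n'"
    proof -
      have pt: "unit_vec i l + d \<alpha> l = unit_vec j l + d \<beta> l" for l
        using fun_cong[OF deg, of l] by simp
      show "d \<alpha> = unit_vec j + n'"
      proof
        fix l show "d \<alpha> l = (unit_vec j + n') l"
          using pt[of l] ij by (auto simp: n'_def unit_vec_def split: if_splits)
      qed
      show "d \<beta> = unit_vec i + n'"
      proof
        fix l show "d \<beta> l = (unit_vec i + n') l"
          using pt[of l] ij by (auto simp: n'_def unit_vec_def split: if_splits)
      qed
    qed
    obtain a \<rho> where a: "a \<in> Lam" "\<rho> \<in> Lam" "s a = r \<rho>" "cmp a \<rho> = \<alpha>" "d a = unit_vec j" "d \<rho> = n'"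
      using factorization[OF \<alpha>(3) \<alpha>n] by metis
    obtain b \<rho>' where b: "b \<in> Lam" "\<rho>' \<in> Lam" "s b = r \<rho>'" "cmp b \<rho>' = \<beta>" "d b = unit_vec i" "d \<rho>' = n'"
      using factorization[OF \<beta>(3) \<beta>n] by metis
    have ea: "s e = r a" using a \<alpha>(4) range_cmp[OF a(1-3)] by simp
    have fb: "s f = r b" using b \<beta>(4) range_cmp[OF b(1-3)] by simp
    have e: "e \<in> Lam" "f \<in> Lam" using \<alpha>(1) \<beta>(1) by auto
    \<comment> \<open>Both sides are initial factors of \<open>\<eta>\<close> of degree
      \<open>unit_vec i + unit_vec j\<close>, so unique factorization yields a commuting square and
      a common tail.\<close>
    have "cmp e a = cmp f b \<and> \<rho> = \<rho>'"
    proof (rule factorization_unique)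
      show "cmp e a \<in> Lam" "cmp f b \<in> Lam" using cmp_in e a b ea fb by auto
      show "s (cmp e a) = r \<rho>" "s (cmp f b) = r \<rho>'" using source_cmp e a b ea fb by auto
      show "cmp (cmp e a) \<rho> = cmp (cmp f b) \<rho>'"
        using cmp_assoc[of e a \<rho>] cmp_assoc[of f b \<rho>'] e a b ea fb \<alpha>(5) \<beta>(5) by simp
      show "d (cmp e a) = d (cmp f b)"
        using degree_cmp[of e a] degree_cmp[of f b] e a b ea fb i j by (simp add: add.commute)
    qed (use a b in auto)
    then have sq: "cmp e a = cmp f b" and \<rho>: "\<rho>' = \<rho>" by auto
    have ab: "edge a" "edge b" using a b i j edgeI by auto
    define gs where "gs = canon \<rho>"
    have gs: "edge_path \<rho> gs" unfolding gs_def using edge_path_canon a by blast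
    have p1: "edge_path \<alpha> (a # gs)" using edge_path.Cons[OF ab(1) gs a(3)] a(4) by simp
    have p2: "edge_path \<beta> (b # gs)" using edge_path.Cons[OF ab(2) gs] b(3,4) \<rho> by simp
    have s\<rho>: "s \<alpha> = s \<rho>" "s \<beta> = s \<rho>" using source_cmp[of a \<rho>] source_cmp[of b \<rho>] a b \<rho> by auto
    have A: "AE z in M. z \<in> V (s \<alpha>) \<longrightarrow> foldr \<tau> es' z = foldr \<tau> (a # gs) z"
      using \<alpha>(2) p1 len by (intro Suc.hyps(1)) auto
    have "length (b # gs) = n"
      using edge_path_length[OF p2] edge_path_length[OF \<beta>(2)] len by simp
    then have B: "AE z in M. z \<in> V (s \<beta>) \<longrightarrow> foldr \<tau> (b # gs) z = foldr \<tau> fs' z"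
      using \<beta>(2) p2 by (intro Suc.hyps(1)) auto
    have "AE z in M. z \<in> D a \<inter> D b \<longrightarrow> \<tau> e (\<tau> a z) = \<tau> f (\<tau> b z)"
      using \<alpha>(1) \<beta>(1) ab ea fb sq i j a b by (intro square_commutes) auto
    from rn_map_AE_pullback[OF path_rn_map this, of gs]
    have C: "AE z in M. z \<in> PD gs \<inter> space M \<longrightarrow> (foldr \<tau> gs z \<in> D a \<inter> D b \<longrightarrow>
        \<tau> e (\<tau> a (foldr \<tau> gs z)) = \<tau> f (\<tau> b (foldr \<tau> gs z)))"
      using edge_pathD(3)[OF gs] by simp
    \<comment> \<open>The map of \<open>es\<close> agrees with that of \<open>e # a # gs\<close>, by
      the square with that of \<open>f # b # gs\<close>, and then with that of \<open>fs\<close>.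
      Definedness of \<open>a # gs\<close> and \<open>b # gs\<close> puts the value of
      \<open>gs\<close> where the square applies.\<close>
    from A B C path_defined_AE[OF p1] path_defined_AE[OF p2] show ?thesis
      unfolding \<alpha>(6) s\<rho> es fs by eventually_elim (use vertex_dom_space in auto)
  qed
qed

lemma ext_defined_AE:
  assumes "\<eta> \<in> Lam"
  shows "AE z in M. z \<in> V (s \<eta>) \<longrightarrow> z \<in> ED \<eta> \<and> ET \<eta> z \<in> V (r \<eta>)"
  using path_defined_AE[OF edge_path_canon[OF assms]]
  by eventually_elim (use assms source_vertex in \<open>auto simp: ext_dom_eq ext_tau_eq\<close>)

section \<open>Covering and disjointness of the ranges in every degree\<close>

text \<open>Condition (v) puts a point of \<open>V v\<close> into the range of an edge
  \<open>g\<close> with range \<open>v\<close>; its preimage lies in \<open>V (s g)\<close>, where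
  the induction applies. Intersecting with \<open>V (s \<eta>)\<close> matters for the empty path,
  whose \<open>PD\<close> is \<open>UNIV\<close>.\<close>

lemma path_cover_AE:
  assumes "set is \<subseteq> {..<k}" "v \<in> Lam" "d v = 0"
  shows "AE z in M. z \<in> V v \<longrightarrow> (\<exists>\<eta> es. edge_path \<eta> es \<and> r \<eta> = v \<and> map d es = map unit_vec is \<and>
    z \<in> foldr \<tau> es ` (PD es \<inter> V (s \<eta>)))"
  using assms
proof (induction "is" arbitrary: v)
  case Nil
  then have "edge_path v []" "r v = v" "s v = v"
    using range_vertex source_vertex edge_path.Nil by blast+
  then show ?case by (intro AE_I2 impI exI[of _ v] exI[of _ "[]"]) auto
next
  case (Cons i "is")
  let ?Q = "\<lambda>is v z. \<exists>\<eta> es. edge_path \<eta> es \<and> r \<eta> = v \<and> map d es = map unit_vec is \<and>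
    z \<in> foldr \<tau> es ` (PD es \<inter> V (s \<eta>))"
  let ?S = "{g\<in>Lam. d g = unit_vec i}"
  have i: "i < k" using Cons by simp
  have "AE z in M. \<forall>g\<in>?S. z \<in> \<tau> g ` D g \<longrightarrow> ?Q (i # is) (r g) z"
  proof (rule AE_finite_allI[OF finite_degree])
    fix g assume "g \<in> ?S"
    then have g: "g \<in> Lam" "d g = unit_vec i" "edge g" using i edgeI by auto
    have "AE x in M. x \<in> V (s g) \<longrightarrow> ?Q is (s g) x"
      using Cons g by (intro Cons.IH) auto
    then have "AE x in M. x \<in> D g \<longrightarrow> ?Q (i # is) (r g) (\<tau> g x)"
    proof eventually_elim
      case (elim x)
      show ?case
      proof
        assume x: "x \<in> D g"
        then have "x \<in> V (s g)" using edge_dom_subset g by blast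
        with elim obtain \<eta> es w where *: "edge_path \<eta> es" "r \<eta> = s g" "map d es = map unit_vec is"
          "x = foldr \<tau> es w" "w \<in> PD es" "w \<in> V (s \<eta>)" by auto
        have "edge_path (cmp g \<eta>) (g # es)" using * g by (intro edge_path.Cons) auto
        moreover have "r (cmp g \<eta>) = r g" "s (cmp g \<eta>) = s \<eta>"
          using * g edge_pathD(1) by (auto simp: range_cmp source_cmp)
        moreover have "\<tau> g x \<in> foldr \<tau> (g # es) ` (PD (g # es) \<inter> V (s \<eta>))"
          using * x by (intro image_eqI[of _ _ w]) auto
        ultimately show "?Q (i # is) (r g) (\<tau> g x)"
          using *(3) g(2) by (intro exI[of _ "cmp g \<eta>"] exI[of _ "g # es"]) auto
      qed
    qed
    then show "AE z in M. z \<in> \<tau> g ` D g \<longrightarrow> ?Q (i # is) (r g) z"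
      by (rule rn_map_AE_image[OF edge_rn_map[OF g(3)]])
  qed
  with vertex_dom_cover[OF Cons.prems(2,3) i] show ?case
    by eventually_elim blast
qed

text \<open>The ranges of degree \<open>unit_vec 0\<close>, a direction that exists by
  \<open>0 < k\<close>, cover the space, and each lies in the domain of its range vertex up to a
  null set.\<close>

lemma vertex_doms_cover_AE: "AE z in M. \<exists>v. v \<in> Lam \<and> d v = 0 \<and> z \<in> V v"
proof -
  let ?S = "{x\<in>Lam. d x = unit_vec 0}"
  have "AE z in M. \<forall>g\<in>?S. z \<in> \<tau> g ` D g \<longrightarrow> z \<in> V (r g)"
    using k_pos edgeI by (intro AE_finite_allI[OF finite_degree] edge_range_in_vertex_dom) auto
  moreover have "AE z in M. z \<in> (\<Union>g\<in>?S. \<tau> g ` D g)"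
  proof -
    have U: "(\<Union>g\<in>?S. \<tau> g ` D g) \<in> sets M"
      using finite_degree edge_range_sets k_pos edgeI by (intro sets.finite_UN) auto
    have "emeasure M (space M - (\<Union>g\<in>?S. \<tau> g ` D g)) = 0"
      using sbfs_edges[OF k_pos] by (simp add: sbfs_iff_rn_map)
    then have "AE z in M. z \<in> space M \<longrightarrow> z \<in> (\<Union>g\<in>?S. \<tau> g ` D g)"
      using U by (subst (asm) emeasure_Diff_eq_0_iff_AE) auto
    with AE_space show ?thesis by eventually_elim auto
  qed
  ultimately show ?thesis
    by eventually_elim (use range_in degree_range in blast)
qed

text \<open>Almost every point lies in some \<open>V v\<close> and then in the range of an edge path
  with the canonical degrees; by uniqueness this is the canonical path of its composite.\<close>

lemma ext_ranges_cover_AE: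
  assumes m: "in_Nk k m"
  shows "AE z in M. z \<in> (\<Union>\<eta>\<in>{x\<in>Lam. d x = m}. ET \<eta> ` ED \<eta>)"
proof -
  let ?is = "canon_indices k m"
  let ?Q = "\<lambda>v z. \<exists>\<eta> es. edge_path \<eta> es \<and> r \<eta> = v \<and> map d es = map unit_vec ?is \<and>
    z \<in> foldr \<tau> es ` (PD es \<inter> V (s \<eta>))"
  have "AE z in M. \<forall>v\<in>{x\<in>Lam. d x = 0}. z \<in> V v \<longrightarrow> ?Q v z"
    using set_canon_indices by (intro AE_finite_allI[OF finite_degree] path_cover_AE) auto
  with vertex_doms_cover_AE show ?thesis
  proof eventually_elim
    case (elim z)
    then obtain \<eta> es w where *: "edge_path \<eta> es" "map d es = map unit_vec ?is"
      "z = foldr \<tau> es w" "w \<in> PD es" "w \<in> V (s \<eta>)" by blast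
    have \<eta>: "\<eta> \<in> Lam" using edge_pathD(1)[OF *(1)] .
    have "d \<eta> = sum_list (canon_degs k m)"
      using edge_pathD(2)[OF *(1)] unfolding *(2) canon_degs_eq .
    then have dm: "d \<eta> = m" using sum_list_canon_degs[OF m] by (rule trans)
    have "es = canon \<eta>"
      using *(1) edge_path_canon[OF \<eta>]
      by (rule edge_path_unique) (simp add: *(2) degrees_canon[OF \<eta>] dm canon_degs_eq)
    then have "z = ET \<eta> w" "w \<in> ED \<eta>"
      using * \<eta> source_vertex by (auto simp: ext_tau_eq ext_dom_eq)
    then show ?case using \<eta> dm by blast
  qed
qed

text \<open>In degree zero this is condition (ii). Otherwise the canonical lists differ, since
  composing a nonempty list recovers its morphism.\<close>

lemma ext_ranges_disjoint_AE:
  assumes "\<eta> \<in> Lam" "\<zeta> \<in> Lam" "d \<eta> = d \<zeta>" "\<eta> \<noteq> \<zeta>"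
  shows "AE z in M. z \<notin> ET \<eta> ` ED \<eta> \<or> z \<notin> ET \<zeta> ` ED \<zeta>"
proof (cases "d \<eta> = 0")
  case True
  then show ?thesis using assms vertex_dom_disjoint[of \<eta> \<zeta>] by (simp add: ext_vertex_range)
next
  case False
  have ne: "canon \<eta> \<noteq> []" "canon \<zeta> \<noteq> []" using False assms canon_eq_Nil_iff by auto
  have "canon \<eta> \<noteq> canon \<zeta>"
    using edge_path_canon[OF assms(1)] edge_path_canon[OF assms(2)] ne assms(4)
    unfolding edge_path_iff_list_comp[OF ne(1)] edge_path_iff_list_comp[OF ne(2)] by auto
  then have "AE z in M. z \<notin> foldr \<tau> (canon \<eta>) ` PD (canon \<eta>) \<or> z \<notin> foldr \<tau> (canon \<zeta>) ` PD (canon \<zeta>)"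
    using edge_pathD(3)[OF edge_path_canon[OF assms(1)]] edge_pathD(3)[OF edge_path_canon[OF assms(2)]]
      degrees_canon assms by (intro path_ranges_disjoint) auto
  then show ?thesis using False assms(3) by (simp add: ext_dom_eq ext_tau_eq)
qed

lemma ext_sbfs:
  assumes m: "in_Nk k m"
  shows "sbfs M {x\<in>Lam. d x = m} ED ET"
  unfolding sbfs_iff_rn_map
proof (intro conjI ballI impI)
  let ?U = "\<Union>\<eta>\<in>{x\<in>Lam. d x = m}. ET \<eta> ` ED \<eta>"
  have "?U \<in> sets M" using finite_degree ext_range_sets by (intro sets.finite_UN) auto
  moreover have "AE z in M. z \<in> space M \<longrightarrow> z \<in> ?U"
    using ext_ranges_cover_AE[OF m] by eventually_elim auto
  ultimately show "emeasure M (space M - ?U) = 0"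
    by (subst emeasure_Diff_eq_0_iff_AE) auto
next
  fix \<eta> \<zeta> assume "\<eta> \<in> {x\<in>Lam. d x = m}" "\<zeta> \<in> {x\<in>Lam. d x = m}" "\<eta> \<noteq> \<zeta>"
  then show "emeasure M (ET \<eta> ` ED \<eta> \<inter> ET \<zeta> ` ED \<zeta>) = 0"
    using ext_ranges_disjoint_AE ext_range_sets by (subst emeasure_Int_eq_0_iff_AE) auto
qed (auto simp: finite_degree ext_rn_map)

section \<open>Composition of prefixing maps and additivity of coding maps\<close>

text \<open>Concatenating the canonical paths of \<open>x\<close> and \<open>y\<close> gives an edge
  path of \<open>cmp x y\<close>, in general not the canonical one, so
  \<open>edge_paths_agree_AE\<close> is needed.\<close>

lemma ext_comp_AE:
  assumes x: "x \<in> Lam" and y: "y \<in> Lam" and xy: "r y = s x"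
  shows "AE z in M. z \<in> ED y \<longrightarrow> ET y z \<in> ED x \<and> ET x (ET y z) = ET (cmp x y) z"
proof -
  have "edge_path (cmp x y) (canon x @ canon y)"
    using x y xy by (intro edge_path_append edge_path_canon) auto
  moreover have "edge_path (cmp x y) (canon (cmp x y))"
    using x y xy by (intro edge_path_canon cmp_in) auto
  ultimately have "AE z in M. z \<in> V (s y) \<longrightarrow>
      foldr \<tau> (canon x @ canon y) z = foldr \<tau> (canon (cmp x y)) z"
    using edge_paths_agree_AE[of "cmp x y"] source_cmp[of x y] x y xy by metis
  moreover have "AE z in M. z \<in> ED y \<longrightarrow> (ET y z \<in> V (s x) \<longrightarrow> ET y z \<in> ED x \<and> ET x (ET y z) \<in> V (r x))"
    using rn_map_AE_pullback[OF ext_rn_map[OF y] ext_defined_AE[OF x]] .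
  ultimately show ?thesis
    using ext_defined_AE[OF y]
    by eventually_elim (use ext_dom_subset[OF y] xy in \<open>auto simp: ext_tau_eq\<close>)
qed

lemma coding_funpow_space: "i < k \<Longrightarrow> z \<in> space M \<Longrightarrow> (c i ^^ n) z \<in> space M"
  by (induction n) (auto simp: coding_space)

lemma coding_funpow_commute:
  assumes "i < k" "j < k" "z \<in> space M"
  shows "(c i ^^ m) ((c j ^^ n) z) = (c j ^^ n) ((c i ^^ m) z)"
proof -
  have 1: "c i ((c j ^^ n) w) = (c j ^^ n) (c i w)" if "w \<in> space M" for w
    using that assms by (induction n) (auto simp: coding_commute[of i j] coding_funpow_space)
  show ?thesis
    using assms by (induction m) (auto simp: 1 coding_funpow_space)
qed

lemma ext_cod_add:
  assumes "z \<in> space M"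
  shows "ext_cod k c m (ext_cod k c n z) = ext_cod k c (m + n) z"
proof -
  have E: "ext_cod (Suc l) c p w = ext_cod l c p ((c l ^^ p l) w)" for l p w
    by (simp add: ext_cod_def)
  \<comment> \<open>Brings the power of the top direction in the outer factor next to the one in the
    inner factor, where \<open>funpow_add\<close> merges them.\<close>
  have com: "(c j ^^ q) (ext_cod l c p w) = ext_cod l c p ((c j ^^ q) w)"
    if "l \<le> k" "j < k" "w \<in> space M" for j q l p w
    using that
  proof (induction l arbitrary: w)
    case (Suc l)
    then show ?case by (simp add: E coding_funpow_space coding_funpow_commute)
  qed (simp add: ext_cod_def)
  have "ext_cod l c m (ext_cod l c n w) = ext_cod l c (m + n) w"
    if "l \<le> k" "w \<in> space M" for l w
    using that
  proof (induction l arbitrary: w)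
    case (Suc l)
    then show ?case by (simp add: E com coding_funpow_space funpow_add)
  qed (simp add: ext_cod_def)
  then show ?thesis using assms by simp
qed

theorem lambda_sbfs_ext: "lambda_sbfs k Lam r s cmp d M ED ET (ext_cod k c)"
  unfolding lambda_sbfs_def
proof (intro conjI allI ballI impI)
  fix m assume m: "in_Nk k m"
  show "sbfs M {x\<in>Lam. d x = m} ED ET" using m by (rule ext_sbfs)
  show "coding_map M {x\<in>Lam. d x = m} ED ET (ext_cod k c m)"
    using coding_ext ext_cod_measurable by (auto simp: coding_map_def)
next
  fix v x assume "v \<in> Lam" "d v = 0"
  then show "ET v x = x" "0 < emeasure M (ED v)"
    using vertex_dom_pos by (auto simp: ext_vertex)
next
  fix x y assume x: "x \<in> Lam" and y: "y \<in> Lam" and xy: "r y = s x"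
  have "AE z in M. z \<in> ED y \<longrightarrow> ET y z \<in> ED x"
    using ext_comp_AE[OF x y xy] by eventually_elim auto
  then have "AE z in M. z \<in> ET y ` ED y \<longrightarrow> z \<in> ED x"
    by (rule rn_map_AE_image[OF ext_rn_map[OF y]])
  then show "emeasure M (ET y ` ED y - ED x) = 0"
    using emeasure_Diff_eq_0_iff_AE ext_range_sets[OF y] ext_dom_sets[OF x] by blast
  show "AE z in M. z \<in> ED y \<longrightarrow> ET x (ET y z) = ET (cmp x y) z"
    using ext_comp_AE[OF x y xy] by eventually_elim auto
qed (rule ext_cod_add)

end


section \<open>The characterisation\<close>

theorem mainTheorem5:
  fixes k :: nat and Lam :: "'a set" and r s :: "'a \<Rightarrow> 'a" and cmp :: "'a \<Rightarrow> 'a \<Rightarrow> 'a"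
    and d :: "'a \<Rightarrow> nat \<Rightarrow> nat" and M :: "'x measure"
    and D :: "'a \<Rightarrow> 'x set" and \<tau> :: "'a \<Rightarrow> 'x \<Rightarrow> 'x" and c :: "nat \<Rightarrow> 'x \<Rightarrow> 'x"
  assumes "1 \<le> k"
    and "finite_kgraph k Lam r s cmp d"
    and "\<forall>i<k. sbfs M {x\<in>Lam. d x = unit_vec i} D \<tau> \<and>
               coding_map M {x\<in>Lam. d x = unit_vec i} D \<tau> (c i)"
  shows
    "( \<comment> \<open>(i)\<close>
       (\<forall>x\<in>Lam. \<forall>y\<in>Lam. is_edge k d x \<longrightarrow> is_edge k d y \<longrightarrow> s x = s y \<longrightarrow>
          emeasure M ((D x - D y) \<union> (D y - D x)) = 0) \<and>
       (\<forall>v\<in>Lam. d v = 0 \<longrightarrow> 0 < emeasure M (vertex_dom k Lam s d D v)) \<and>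
       \<comment> \<open>(ii)\<close>
       (\<forall>v\<in>Lam. \<forall>w\<in>Lam. d v = 0 \<longrightarrow> d w = 0 \<longrightarrow> v \<noteq> w \<longrightarrow>
          emeasure M (vertex_dom k Lam s d D v \<inter> vertex_dom k Lam s d D w) = 0) \<and>
       \<comment> \<open>(iii)\<close>
       (\<forall>i<k. \<forall>j<k. \<forall>x\<in>Lam. \<forall>a\<in>Lam. \<forall>y\<in>Lam. \<forall>b\<in>Lam.
          d x = unit_vec i \<longrightarrow> d b = unit_vec i \<longrightarrow> d y = unit_vec j \<longrightarrow> d a = unit_vec j \<longrightarrow>
          s x = r a \<longrightarrow> s y = r b \<longrightarrow> cmp x a = cmp y b \<longrightarrow>
          emeasure M (\<tau> a ` D a - D x) = 0 \<and> emeasure M (\<tau> b ` D b - D y) = 0 \<and>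
          (AE z in M. z \<in> D a \<inter> D b \<longrightarrow> \<tau> x (\<tau> a z) = \<tau> y (\<tau> b z))) \<and>
       \<comment> \<open>(iv)\<close>
       (\<forall>i<k. \<forall>j<k. \<forall>z\<in>space M. c i (c j z) = c j (c i z)) \<and>
       \<comment> \<open>(v)\<close>
       (\<forall>v\<in>Lam. \<forall>i<k. d v = 0 \<longrightarrow>
          emeasure M (vertex_dom k Lam s d D v -
             (\<Union>g\<in>{g\<in>Lam. d g = unit_vec i \<and> r g = v}. \<tau> g ` D g)) = 0))
     \<longleftrightarrow>
     lambda_sbfs k Lam r s cmp d M
        (ext_dom k Lam r s cmp d D \<tau>) (ext_tau k Lam r s cmp d \<tau>) (ext_cod k c)"
proof -
  interpret edge_system k Lam r s cmp d M D \<tau> c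
    using assms by unfold_locales (auto simp: finite_kgraph_def)
  have sd_iff: "emeasure M ((D x - D y) \<union> (D y - D x)) = 0 \<longleftrightarrow>
      (AE z in M. z \<in> D x \<longrightarrow> z \<in> D y) \<and> (AE z in M. z \<in> D y \<longrightarrow> z \<in> D x)"
    if "edge x" "edge y" for x y
  proof -
    have s: "D x - D y \<in> sets M" "D y - D x \<in> sets M" using that edge_dom_sets by auto
    then have "emeasure M ((D x - D y) \<union> (D y - D x)) = 0 \<longleftrightarrow>
        emeasure M (D x - D y) = 0 \<and> emeasure M (D y - D x) = 0"
      by (subst plus_emeasure[symmetric]) auto
    then show ?thesis using that edge_dom_sets by (simp add: emeasure_Diff_eq_0_iff_AE)
  qed
  have cover_sets: "(\<Union>g\<in>{g\<in>Lam. d g = unit_vec i \<and> r g = v}. \<tau> g ` D g) \<in> sets M" if "i < k" for i v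
  proof (rule sets.finite_UN)
    show "finite {g\<in>Lam. d g = unit_vec i \<and> r g = v}"
      using finite_degree[of "unit_vec i"] by (rule rev_finite_subset) auto
  qed (use that edgeI edge_range_sets in auto)
  show ?thesis (is "(?i \<and> ?pos \<and> ?ii \<and> ?iii \<and> ?iv \<and> ?v) \<longleftrightarrow> ?sys")
  proof
    assume conds: "?i \<and> ?pos \<and> ?ii \<and> ?iii \<and> ?iv \<and> ?v"
    note i = conds[THEN conjunct1] and pos = conds[THEN conjunct2, THEN conjunct1]
      and ii = conds[THEN conjunct2, THEN conjunct2, THEN conjunct1]
      and iii = conds[THEN conjunct2, THEN conjunct2, THEN conjunct2, THEN conjunct1]
      and iv = conds[THEN conjunct2, THEN conjunct2, THEN conjunct2, THEN conjunct2, THEN conjunct1]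
      and v = conds[THEN conjunct2, THEN conjunct2, THEN conjunct2, THEN conjunct2, THEN conjunct2]
    interpret compatible_edge_system k Lam r s cmp d M D \<tau> c
    proof
      fix x y assume "edge x" "edge y" "s x = s y"
      then show "AE z in M. z \<in> D x \<longrightarrow> z \<in> D y" using i sd_iff by blast
    next
      fix v assume "v \<in> Lam" "d v = 0"
      then show "0 < emeasure M (V v)" using pos by blast
    next
      fix v w assume "v \<in> Lam" "w \<in> Lam" "d v = 0" "d w = 0" "v \<noteq> w"
      then have "emeasure M (V v \<inter> V w) = 0" using ii by blast
      then show "AE z in M. z \<notin> V v \<or> z \<notin> V w"
        using emeasure_Int_eq_0_iff_AE vertex_dom_sets by blast
    next
      fix x a assume x: "edge x" and a: "edge a" and xa: "s x = r a"
      obtain i j where i: "i < k" "d x = unit_vec i" and j: "j < k" "d a = unit_vec j"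
        using x a by (metis edgeE)
      have "cmp x a \<in> Lam" "d (cmp x a) = unit_vec j + unit_vec i"
        using cmp_in degree_cmp x a xa i j by (auto simp: add.commute)
      then obtain y b where "y \<in> Lam" "b \<in> Lam" "s y = r b" "cmp y b = cmp x a"
        "d y = unit_vec j" "d b = unit_vec i"
        using factorization by metis
      then have "emeasure M (\<tau> a ` D a - D x) = 0"
        using iii[rule_format, of i j x a y b] i j x a xa by simp
      then show "AE z in M. z \<in> \<tau> a ` D a \<longrightarrow> z \<in> D x"
        using emeasure_Diff_eq_0_iff_AE edge_range_sets[OF a] edge_dom_sets[OF x] by blast
    next
      fix x a y b assume e: "edge x" "edge a" "edge y" "edge b" and deg: "d x = d b" "d y = d a"
        and c: "s x = r a" "s y = r b" "cmp x a = cmp y b"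
      obtain i j where i: "i < k" "d x = unit_vec i" and j: "j < k" "d a = unit_vec j"
        using e(1,2) by (metis edgeE)
      then show "AE z in M. z \<in> D a \<inter> D b \<longrightarrow> \<tau> x (\<tau> a z) = \<tau> y (\<tau> b z)"
        using iii[rule_format, of i j x a y b] e deg c by simp
    next
      fix i j z assume "i < k" "j < k" "z \<in> space M"
      then show "c i (c j z) = c j (c i z)" using iv by blast
    next
      fix w i assume w: "w \<in> Lam" "d w = 0" "i < k"
      then have "emeasure M (V w - (\<Union>g\<in>{g\<in>Lam. d g = unit_vec i \<and> r g = w}. \<tau> g ` D g)) = 0"
        using v by blast
      then have "AE z in M. z \<in> V w \<longrightarrow> z \<in> (\<Union>g\<in>{g\<in>Lam. d g = unit_vec i \<and> r g = w}. \<tau> g ` D g)"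
        using emeasure_Diff_eq_0_iff_AE[OF vertex_dom_sets cover_sets[OF w(3)]] by blast
      then show "AE z in M. z \<in> V w \<longrightarrow> (\<exists>g. g \<in> Lam \<and> d g = unit_vec i \<and> r g = w \<and> z \<in> \<tau> g ` D g)"
        by eventually_elim blast
    qed
    show ?sys by (rule lambda_sbfs_ext)
  next
    assume sys: ?sys
    have a: "sbfs M {x\<in>Lam. d x = m} ED ET" if "in_Nk k m" for m
      using sys that by (simp add: lambda_sbfs_def)
    have b: "0 < emeasure M (ED v)" if "v \<in> Lam" "d v = 0" for v
      using sys that by (simp add: lambda_sbfs_def)
    have c1: "AE z in M. z \<in> ET y ` ED y \<longrightarrow> z \<in> ED x" if "x \<in> Lam" "y \<in> Lam" "r y = s x" for x y
    proof -
      have "emeasure M (ET y ` ED y - ED x) = 0"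
        using sys that by (simp add: lambda_sbfs_def)
      then show ?thesis
        using emeasure_Diff_eq_0_iff_AE ext_range_sets[OF that(2)] ext_dom_sets[OF that(1)] by blast
    qed
    have c2: "AE z in M. z \<in> ED y \<longrightarrow> ET x (ET y z) = ET (cmp x y) z"
      if "x \<in> Lam" "y \<in> Lam" "r y = s x" for x y
      using sys that by (simp add: lambda_sbfs_def)
    have dd: "ext_cod k c m (ext_cod k c n z) = ext_cod k c (m + n) z"
      if "in_Nk k m" "in_Nk k n" "z \<in> space M" for m n z
      using sys that by (simp add: lambda_sbfs_def)
    have unit: "in_Nk k (unit_vec i)" if "i < k" for i
      using that by (auto simp: in_Nk_def unit_vec_def)
    have zero: "in_Nk k 0" by (simp add: in_Nk_def)
    have src: "AE z in M. z \<in> D y \<longrightarrow> z \<in> D x" if "edge x" "edge y" "s x = s y" for x y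
    proof -
      have sx: "s x \<in> Lam" "d (s x) = 0" "r (s x) = s x" using that range_vertex by auto
      \<comment> \<open>Axiom (c) for \<open>x\<close> followed by the vertex \<open>s x\<close>,
        whose range is \<open>V (s x)\<close>: so \<open>D x\<close> fills
        \<open>V (s x)\<close>.\<close>
      from c1[of x "s x"] have "AE z in M. z \<in> V (s x) \<longrightarrow> z \<in> D x"
        using sx that ext_vertex_range[of "s x"] ext_edge(1)[of x] by simp
      then show ?thesis
        by eventually_elim (use edge_dom_subset[OF that(2)] that(3) in auto)
    qed
    have disj: "emeasure M (V v \<inter> V w) = 0" if "v \<in> Lam" "w \<in> Lam" "d v = 0" "d w = 0" "v \<noteq> w" for v w
    proof -
      \<comment> \<open>In degree zero the ranges are the sets \<open>V v\<close>, so (ii) is the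
        disjointness part of (a).\<close>
      have "emeasure M (ET v ` ED v \<inter> ET w ` ED w) = 0"
        using a[OF zero] that unfolding sbfs_iff_rn_map by blast
      then show ?thesis using that by (simp add: ext_vertex_range)
    qed
    show "?i \<and> ?pos \<and> ?ii \<and> ?iii \<and> ?iv \<and> ?v"
    proof (intro conjI)
      show ?i using src sd_iff by simp
      show ?pos using b ext_vertex(1) by simp
      show ?ii using disj by blast
      show ?iii
      proof (intro allI ballI impI)
        fix i j x a y b
        assume ij: "i < k" "j < k" and L: "x \<in> Lam" "a \<in> Lam" "y \<in> Lam" "b \<in> Lam"
          and deg: "d x = unit_vec i" "d b = unit_vec i" "d y = unit_vec j" "d a = unit_vec j"
          and comp: "s x = r a" "s y = r b" "cmp x a = cmp y b"
        have e: "edge x" "edge a" "edge y" "edge b" using ij L deg edgeI by auto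
        have "AE z in M. z \<in> \<tau> a ` D a \<longrightarrow> z \<in> D x" "AE z in M. z \<in> \<tau> b ` D b \<longrightarrow> z \<in> D y"
          using c1[of x a] c1[of y b] L comp ext_edge_range ext_edge(1) e by simp_all
        then have "emeasure M (\<tau> a ` D a - D x) = 0" "emeasure M (\<tau> b ` D b - D y) = 0"
          using emeasure_Diff_eq_0_iff_AE edge_range_sets edge_dom_sets e by blast+
        moreover have "AE z in M. z \<in> D a \<inter> D b \<longrightarrow> \<tau> x (\<tau> a z) = \<tau> y (\<tau> b z)"
          using c2[OF L(1,2) comp(1)[symmetric]] c2[OF L(3,4) comp(2)[symmetric]]
          by eventually_elim (use comp(3) e in \<open>auto simp: ext_edge\<close>)
        ultimately show "emeasure M (\<tau> a ` D a - D x) = 0 \<and> emeasure M (\<tau> b ` D b - D y) = 0 \<and>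
          (AE z in M. z \<in> D a \<inter> D b \<longrightarrow> \<tau> x (\<tau> a z) = \<tau> y (\<tau> b z))" by blast
      qed
      show ?iv
      proof (intro allI ballI impI)
        fix i j z assume "i < k" "j < k" "z \<in> space M"
        \<comment> \<open>Both composites are the coding map of degree
          \<open>unit_vec i + unit_vec j\<close>.\<close>
        then show "c i (c j z) = c j (c i z)"
          using dd[OF unit unit, of i j z] dd[OF unit unit, of j i z]
          by (simp add: ext_cod_unit_vec add.commute)
      qed
      show ?v
      proof (intro allI ballI impI)
        fix v i assume v: "v \<in> Lam" "d v = 0" and i: "i < k"
        let ?S = "{g\<in>Lam. d g = unit_vec i}"
        let ?W = "{w\<in>Lam. d w = 0}"
        let ?U = "\<Union>g\<in>{g\<in>Lam. d g = unit_vec i \<and> r g = v}. \<tau> g ` D g"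
        have US: "(\<Union>g\<in>?S. \<tau> g ` D g) \<in> sets M"
          using finite_degree edge_range_sets i edgeI by (intro sets.finite_UN) auto
        have "emeasure M (space M - (\<Union>g\<in>?S. \<tau> g ` D g)) = 0"
          using sbfs_edges[OF i] by (simp add: sbfs_iff_rn_map)
        then have 1: "AE z in M. z \<in> space M \<longrightarrow> z \<in> (\<Union>g\<in>?S. \<tau> g ` D g)"
          using US by (subst (asm) emeasure_Diff_eq_0_iff_AE) auto
        have 2: "AE z in M. \<forall>g\<in>?S. z \<in> \<tau> g ` D g \<longrightarrow> z \<in> V (r g)"
        proof (rule AE_finite_allI[OF finite_degree])
          fix g assume "g \<in> ?S"
          then have g: "edge g" using i edgeI by auto
          \<comment> \<open>Axiom (c) for the vertex \<open>r g\<close> followed by \<open>g\<close>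
            places the range of \<open>g\<close> in \<open>V (r g)\<close>.\<close>
          then have "r g \<in> Lam" "d (r g) = 0" "s (r g) = r g" using source_vertex by auto
          then show "AE z in M. z \<in> \<tau> g ` D g \<longrightarrow> z \<in> V (r g)"
            using c1[of "r g" g] g ext_edge_range[OF g] ext_vertex(1)[of "r g"] by simp
        qed
        have 3: "AE z in M. \<forall>w\<in>?W. w \<noteq> v \<longrightarrow> z \<notin> V v \<or> z \<notin> V w"
        proof (rule AE_finite_allI[OF finite_degree])
          fix w assume "w \<in> ?W"
          then show "AE z in M. w \<noteq> v \<longrightarrow> z \<notin> V v \<or> z \<notin> V w"
            using disj[of v w] v emeasure_Int_eq_0_iff_AE[OF vertex_dom_sets vertex_dom_sets, of v w]
            by (cases "w = v") auto
        qed
        from 1 2 3 have "AE z in M. z \<in> V v \<longrightarrow> z \<in> ?U"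
        proof eventually_elim
          case (elim z)
          show ?case
          proof
            assume z: "z \<in> V v"
            then obtain g where g: "g \<in> ?S" "z \<in> \<tau> g ` D g"
              using elim(1) vertex_dom_space by blast
            then have "z \<in> V (r g)" "r g \<in> ?W" using elim(2) by auto
            then have "r g = v" using elim(3) z by blast
            with g show "z \<in> ?U" by blast
          qed
        qed
        then show "emeasure M (V v - ?U) = 0"
          using emeasure_Diff_eq_0_iff_AE[OF vertex_dom_sets cover_sets[OF i]] by blast
      qed
    qed
  qed
qed

end
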